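(* Fix a positive integer $q$ and an arbitrary $\epsilon>0$. Let $P_n$ be a random many-to-one school choice problem with $n$ schools of quota $q$ and $nq$ students. With probability tending to $1$ as $n\to\infty$, every cycle packing $H$ of the envy digraph $G^{\mathrm{DA}(P_n)}$ satisfies $|V(H)|\ge(1-\epsilon)nq$.
   Context: A random many-to-one school choice problem $P_n$ with quota $q$: a set $S$ of $n$ schools, each with quota $q$, and a set $I$ of $nq$ students; each student's strict preference over $S$ and each school's strict priority over $I$ are uniformly random linear orders, all mutually independent. $\mathrm{DA}(P_n)$ is the matching produced by student-proposing deferred acceptance: in each round every student not tentatively held applies to her most preferred school that has not yet rejected her; each school tentatively holds its $q$ highest-priority applicants and rejects the rest; stop when a round has no new rejection. The envy digraph $G^{\mathrm{DA}(P_n)}$ has vertex set $I$ and a directed edge $(i,j)$ iff $i$ strictly prefers $\mathrm{DA}_j(P_n)$ to $\mathrm{DA}_i(P_n)$. A cycle packing $H$ of a digraph $G$ is a union of pairwise vertex-disjoint directed cycles of $G$ (each visiting distinct vertices) such that the subgraph of $G$ induced on the vertices not covered by $H$ contains no directed cycle; $V(H)$ is the set of vertices covered by $H$. *)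

theory Defs
  imports Complex_Main "HOL-Combinatorics.Multiset_Permutations"
begin

text \<open>Schools are 0..<n, students are 0..<n*q. A strict linear order on a finite
set A is encoded as a list in permutations_of_set A, listed from most preferred
(highest priority) to least preferred.\<close>

definition pos :: "'a list \<Rightarrow> 'a \<Rightarrow> nat" where
  "pos xs x = (LEAST k. k < length xs \<and> xs ! k = x)"

type_synonym sc_instance = "(nat \<Rightarrow> nat list) \<times> (nat \<Rightarrow> nat list)"

definition instances :: "nat \<Rightarrow> nat \<Rightarrow> sc_instance set" where
  "instances n q =
     (PiE {0..<n*q} (\<lambda>_. permutations_of_set {0..<n})) \<times>
     (PiE {0..<n} (\<lambda>_. permutations_of_set {0..<n*q}))"

text \<open>DA state: k i = number of rejections student i has received so far;
student i currently applies to the (k i)-th school in her list (if k i < n).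
Tentatively held students keep applying to the school holding them, so one
step is exactly one round of student-proposing deferred acceptance.\<close>

definition applicants :: "nat \<Rightarrow> nat \<Rightarrow> sc_instance \<Rightarrow> (nat \<Rightarrow> nat) \<Rightarrow> nat \<Rightarrow> nat set" where
  "applicants n q P k s =
     {i \<in> {0..<n*q}. k i < n \<and> fst P i ! k i = s}"

definition rejected :: "nat \<Rightarrow> nat \<Rightarrow> sc_instance \<Rightarrow> (nat \<Rightarrow> nat) \<Rightarrow> nat \<Rightarrow> bool" where
  "rejected n q P k i \<longleftrightarrow>
     i \<in> {0..<n*q} \<and> k i < n \<and>
     (let s = fst P i ! k i in
        q \<le> card {j \<in> applicants n q P k s. pos (snd P s) j < pos (snd P s) i})"

definition da_step :: "nat \<Rightarrow> nat \<Rightarrow> sc_instance \<Rightarrow> (nat \<Rightarrow> nat) \<Rightarrow> (nat \<Rightarrow> nat)" where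
  "da_step n q P k = (\<lambda>i. if rejected n q P k i then Suc (k i) else k i)"

text \<open>Each round with a rejection increases the sum of the k i, which is
bounded by n*q*n, so after n*n*q+1 rounds a round without rejection has been
reached; da_step is the identity from then on.\<close>
definition da_state :: "nat \<Rightarrow> nat \<Rightarrow> sc_instance \<Rightarrow> (nat \<Rightarrow> nat)" where
  "da_state n q P = (da_step n q P ^^ (n*n*q + 1)) (\<lambda>_. 0)"

text \<open>The school assigned to student i by DA (every student is matched since
total capacity n*q equals the number of students).\<close>
definition DA :: "nat \<Rightarrow> nat \<Rightarrow> sc_instance \<Rightarrow> nat \<Rightarrow> nat" where
  "DA n q P i = fst P i ! da_state n q P i"

definition envy :: "nat \<Rightarrow> nat \<Rightarrow> sc_instance \<Rightarrow> nat \<Rightarrow> nat \<Rightarrow> bool" where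
  "envy n q P i j \<longleftrightarrow> i \<in> {0..<n*q} \<and> j \<in> {0..<n*q} \<and>
     pos (fst P i) (DA n q P j) < pos (fst P i) (DA n q P i)"

definition is_dcycle :: "'a set \<Rightarrow> ('a \<Rightarrow> 'a \<Rightarrow> bool) \<Rightarrow> 'a list \<Rightarrow> bool" where
  "is_dcycle V E c \<longleftrightarrow> c \<noteq> [] \<and> distinct c \<and> set c \<subseteq> V \<and>
     (\<forall>k < length c. E (c ! k) (c ! ((k + 1) mod length c)))"

definition cover :: "'a list set \<Rightarrow> 'a set" where
  "cover H = (\<Union>c\<in>H. set c)"

definition cycle_packing :: "'a set \<Rightarrow> ('a \<Rightarrow> 'a \<Rightarrow> bool) \<Rightarrow> 'a list set \<Rightarrow> bool" where
  "cycle_packing V E H \<longleftrightarrow>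
     (\<forall>c\<in>H. is_dcycle V E c) \<and>
     (\<forall>c\<in>H. \<forall>d\<in>H. c \<noteq> d \<longrightarrow> set c \<inter> set d = {}) \<and>
     acyclic {(x, y). x \<in> V - cover H \<and> y \<in> V - cover H \<and> E x y}"

end

theory Submission
  imports Defs
begin

text \<open>
If a cycle packing leaves a set \<open>U\<close> of more than \<open>\<epsilon> n q\<close> students uncovered, then \<open>U\<close> is acyclic, so it
splits into two halves \<open>A\<close> and \<open>B\<close> such that nobody in \<open>A\<close> envies anybody in \<open>B\<close>: the students in \<open>A\<close>
were never rejected by any of the linearly many schools \<open>S\<close> assigned to \<open>B\<close>. For a large constant
\<open>C\<close>, a union bound over \<open>(A, S)\<close> shows that with high probability no linear-size set of students has
its first \<open>C\<close> choices disjoint from a linear-size set of schools. It remains to show that a fixed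
student \<open>i\<^sub>0\<close> is rejected at least \<open>C\<close> times with probability tending to 1.

Run deferred acceptance without \<open>i\<^sub>0\<close>, one application at a time. By stability, the school that finally
admits \<open>i\<^sub>0\<close> ranks fewer than \<open>q\<close> of its applicants in this run above \<open>i\<^sub>0\<close>, and the rank of \<open>i\<^sub>0\<close> among
them is uniform because the run only inspects their relative order. So it suffices that most schools
receive at least \<open>M\<close> applications. For fixed priorities the run is determined by the sequence of
schools applied to, and when every student applies at most \<open>L\<close> times this sequence is, up to a
constant factor in probability, a uniformly random word of length \<open>K n\<close>. Such a word misses linearly
many schools, so the run does not stop before \<open>K n\<close> applications, and for large \<open>K\<close> it hits most
schools at least \<open>M\<close> times.
\<close>

subsection \<open>Counting linear orders\<close>

lemma card_eq_sum_fibres: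
  assumes "finite S"
  shows "card S = (\<Sum>y\<in>h ` S. card {x\<in>S. h x = y})"
proof -
  have "(\<Sum>y\<in>h ` S. sum (\<lambda>_. 1) {x\<in>S. h x = y}) = sum (\<lambda>_. 1::nat) S"
    by (rule sum.group) (use assms in auto)
  then show ?thesis by simp
qed

text \<open>The quotient of the two factorials is a product of \<open>c\<close> factors, each at
  least \<open>n - L\<close>.\<close>

lemma power_diff_mult_fact_le:
  assumes "c \<le> L" "L \<le> n"
  shows "(n - L) ^ c * fact (n - c) \<le> (fact n :: nat)"
  using assms(1)
proof (induction c)
  case 0
  then show ?case by simp
next
  case (Suc c)
  have "fact (n - c) = (n - c) * (fact (n - Suc c) :: nat)"
    using Suc.prems assms(2) by (metis Suc_diff_Suc Suc_le_lessD fact_Suc of_nat_id order_less_le_trans)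
  moreover have "n - L \<le> n - c" using Suc.prems by simp
  ultimately have "(n - L) * fact (n - Suc c) \<le> (fact (n - c) :: nat)"
    by (metis mult_le_mono1)
  then have "(n - L) ^ c * ((n - L) * fact (n - Suc c)) \<le> (n - L) ^ c * (fact (n - c) :: nat)"
    by (rule mult_le_mono2)
  also have "\<dots> \<le> fact n" using Suc by simp
  finally show ?case by (simp add: mult.assoc mult.left_commute)
qed

text \<open>After the prefix only the order of the other \<open>n - c\<close> elements is free. The
  base \<open>n - L\<close> does not depend on \<open>c\<close>, so bounds for students with
  different numbers of applications can be multiplied.\<close>

lemma card_permutations_with_prefix_le:
  assumes "finite A" "card A = n" "c \<le> L" "L \<le> n"
  shows "card {xs \<in> permutations_of_set A. take c xs = w} * (n - L) ^ c \<le> fact n"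
proof (cases "{xs \<in> permutations_of_set A. take c xs = w} = {}")
  case True
  then show ?thesis by (simp only: card.empty mult_zero_left zero_le)
next
  case False
  let ?X = "{xs \<in> permutations_of_set A. take c xs = w}"
  have w: "set w \<subseteq> A" "distinct w" "length w = c"
    using False assms by (auto simp: permutations_of_set_def dest: in_set_takeD distinct_card)
  have inj: "inj_on (drop c) ?X"
    by (rule inj_onI) (metis (mono_tags, lifting) append_take_drop_id mem_Collect_eq)
  have "drop c xs \<in> permutations_of_set (A - set w)" if "xs \<in> ?X" for xs
  proof -
    have "xs = w @ drop c xs"
      using that append_take_drop_id[of c xs] by auto
    then obtain d where "xs = w @ d" "drop c xs = d" by blast
    moreover have "distinct xs" "set xs = A" using that by (auto simp: permutations_of_set_def)
    ultimately show ?thesis by (auto simp: permutations_of_set_def)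
  qed
  then have "card ?X \<le> card (permutations_of_set (A - set w))"
    by (intro card_inj_on_le[OF inj]) auto
  also have "\<dots> = fact (n - c)"
    using w assms by (simp add: card_Diff_subset distinct_card)
  finally have "card ?X * (n - L) ^ c \<le> fact (n - c) * (n - L) ^ c" by simp
  also have "\<dots> \<le> fact n" using power_diff_mult_fact_le[OF assms(3,4)] by (simp add: mult.commute)
  finally show ?thesis .
qed

text \<open>Sum of the prefix bound over all words of length \<open>C\<close> that avoid
  \<open>B\<close>.\<close>

lemma card_permutations_prefix_avoiding_le:
  assumes "finite A" "card A = n" "C \<le> n" "B \<subseteq> A"
  shows "card {xs \<in> permutations_of_set A. set (take C xs) \<inter> B = {}} * (n - C) ^ C
    \<le> (n - card B) ^ C * fact n"
proof -
  let ?X = "{xs \<in> permutations_of_set A. set (take C xs) \<inter> B = {}}"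
  let ?W = "{w. set w \<subseteq> A - B \<and> length w = C}"
  have fin: "finite ?W" using assms(1) by (simp add: finite_lists_length_eq)
  have sub: "take C ` ?X \<subseteq> ?W"
  proof
    fix w assume "w \<in> take C ` ?X"
    then obtain xs where xs: "xs \<in> permutations_of_set A" "set (take C xs) \<inter> B = {}" "w = take C xs"
      by auto
    have "length xs = n" using xs(1) assms by (simp add: length_finite_permutations_of_set)
    then show "w \<in> ?W" using xs assms(3) permutations_of_setD(1)[OF xs(1)] by (auto dest: in_set_takeD)
  qed
  have "card ?X = (\<Sum>w\<in>take C ` ?X. card {xs\<in>?X. take C xs = w})"
    by (rule card_eq_sum_fibres) simp
  also have "\<dots> \<le> (\<Sum>w\<in>?W. card {xs\<in>?X. take C xs = w})"
    by (rule sum_mono2[OF fin sub]) simp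
  finally have "card ?X * (n - C) ^ C \<le> (\<Sum>w\<in>?W. card {xs\<in>?X. take C xs = w}) * (n - C) ^ C"
    by (rule mult_le_mono1)
  also have "\<dots> = (\<Sum>w\<in>?W. card {xs\<in>?X. take C xs = w} * (n - C) ^ C)"
    by (rule sum_distrib_right)
  also have "\<dots> \<le> (\<Sum>w\<in>?W. fact n)"
  proof (rule sum_mono)
    fix w
    have "card {xs\<in>?X. take C xs = w} \<le> card {xs \<in> permutations_of_set A. take C xs = w}"
      by (rule card_mono) auto
    then show "card {xs\<in>?X. take C xs = w} * (n - C) ^ C \<le> fact n"
      using card_permutations_with_prefix_le[OF assms(1,2) order_refl assms(3), of w]
      by (meson le_trans mult_le_mono1)
  qed
  also have "\<dots> = (n - card B) ^ C * fact n"
    using assms finite_subset[OF assms(4,1)]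
    by (simp add: card_lists_length_eq card_Diff_subset)
  finally show ?thesis .
qed

lemma card_permutations_map:
  assumes "p permutes A"
  shows "card {xs \<in> permutations_of_set A. Q (map p xs)} = card {xs \<in> permutations_of_set A. Q xs}"
proof (rule bij_betw_same_card[of "map p"], rule bij_betw_imageI)
  have "inj p" using assms by (rule permutes_inj)
  then show "inj_on (map p) {xs \<in> permutations_of_set A. Q (map p xs)}"
    by (meson inj_mapI subset_UNIV inj_on_subset)
  show "map p ` {xs \<in> permutations_of_set A. Q (map p xs)} = {xs \<in> permutations_of_set A. Q xs}"
    using permutations_of_set_image_permutes[OF assms] by (auto simp: image_iff)
qed

text \<open>Transposing \<open>a\<close> and \<open>b\<close> in every order shows that all elements
  are equally likely to stand at position \<open>c\<close>.\<close>

lemma card_permutations_nth: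
  assumes "finite A" "c < card A" "B \<subseteq> A"
  shows "card A * card {xs \<in> permutations_of_set A. xs ! c \<in> B} = card B * fact (card A)"
proof -
  let ?P = "permutations_of_set A"
  have len: "length xs = card A" if "xs \<in> ?P" for xs
    using that assms by (simp add: length_finite_permutations_of_set)
  have mem: "xs ! c \<in> A" if "xs \<in> ?P" for xs
    using that len[OF that] assms(2) permutations_of_setD(1)[OF that] nth_mem by metis
  obtain a where a: "a \<in> A" using assms(2) by fastforce
  define h where "h = card {xs \<in> ?P. xs ! c = a}"
  have fib: "card {xs \<in> ?P. xs ! c = b} = h" if "b \<in> A" for b
  proof -
    have "{xs \<in> ?P. xs ! c = a} = {xs \<in> ?P. map (transpose a b) xs ! c = b}"
      using len assms(2) by (auto simp: transpose_def split: if_splits)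
    then show ?thesis unfolding h_def
      using card_permutations_map[OF permutes_swap_id[OF a that], of "\<lambda>xs. xs ! c = b"] by simp
  qed
  have cnt: "card {xs \<in> ?P. xs ! c \<in> D} = card D * h" if "D \<subseteq> A" for D
  proof -
    have fD: "finite D" using that assms(1) finite_subset by auto
    have "{xs \<in> ?P. xs ! c \<in> D} = (\<Union>d\<in>D. {xs \<in> ?P. xs ! c = d})" by auto
    also have "card \<dots> = (\<Sum>d\<in>D. card {xs \<in> ?P. xs ! c = d})"
      by (rule card_UN_disjoint) (use fD in auto)
    also have "\<dots> = (\<Sum>d\<in>D. h)" by (rule sum.cong) (use fib that in auto)
    finally show ?thesis by simp
  qed
  have "{xs \<in> ?P. xs ! c \<in> A} = ?P" using mem by auto
  then have "fact (card A) = card A * h" using cnt[of A] assms(1) by simp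
  then show ?thesis using cnt[OF assms(3)] by simp
qed

text \<open>Exchanging coordinate \<open>i\<close> of \<open>f\<close> with \<open>x\<close> is an
  involution on the pairs \<open>(f, x)\<close>. So one coordinate may be redrawn uniformly and
  averaged first, with all others frozen.\<close>

lemma sum_resample_coordinate:
  fixes \<phi> :: "('a \<Rightarrow> 'b) \<Rightarrow> nat"
  assumes "i \<in> I"
  shows "card (A i) * (\<Sum>f\<in>PiE I A. \<phi> f) = (\<Sum>f\<in>PiE I A. \<Sum>x\<in>A i. \<phi> (f(i := x)))"
proof -
  have "card (A i) * (\<Sum>f\<in>PiE I A. \<phi> f) = (\<Sum>f\<in>PiE I A. \<Sum>x\<in>A i. \<phi> f)"
    by (simp add: sum_distrib_left mult.commute)
  also have "\<dots> = (\<Sum>(f, x)\<in>PiE I A \<times> A i. \<phi> f)"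
    by (rule sum.cartesian_product)
  also have "\<dots> = (\<Sum>(f, x)\<in>PiE I A \<times> A i. \<phi> (f(i := x)))"
    by (rule sum.reindex_bij_witness[where i="\<lambda>(f, x). (f(i := x), f i)" and j="\<lambda>(f, x). (f(i := x), f i)"])
      (use assms in \<open>auto simp: PiE_def Pi_def extensional_def\<close>)
  also have "\<dots> = (\<Sum>f\<in>PiE I A. \<Sum>x\<in>A i. \<phi> (f(i := x)))"
    by (rule sum.cartesian_product[symmetric])
  finally show ?thesis .
qed

section \<open>Positions in a linear order and the orders induced on subsets\<close>

lemma pos_Cons:
  assumes "x \<in> set (a # xs)"
  shows "pos (a # xs) x = (if a = x then 0 else Suc (pos xs x))"
proof (cases "a = x")
  case True
  then show ?thesis unfolding pos_def by (auto intro: Least_equality)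
next
  case False
  then obtain m where m: "m < length xs" "xs ! m = x" using assms by (auto simp: in_set_conv_nth)
  have "pos (a # xs) x = Suc (LEAST k. Suc k < length (a # xs) \<and> (a # xs) ! Suc k = x)"
    unfolding pos_def by (rule Least_Suc[of _ "Suc m"]) (use m False in auto)
  then show ?thesis using False by (simp add: pos_def)
qed

text \<open>Used to see that a run which compares only students of one set depends on a priority
  list only through the order induced on that set.\<close>

lemma pos_less_filter:
  assumes "x \<in> set xs" "y \<in> set xs" "Q x" "Q y"
  shows "pos xs x < pos xs y \<longleftrightarrow> pos (filter Q xs) x < pos (filter Q xs) y"
  using assms(1,2)
proof (induction xs)
  case Nil
  then show ?case by simp
next
  case (Cons a xs)
  then show ?case using assms(3,4) by (auto simp: pos_Cons)
qed

lemma pos_nth: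
  assumes "distinct xs" "k < length xs"
  shows "pos xs (xs ! k) = k"
  unfolding pos_def using assms by (intro Least_equality) (auto simp: nth_eq_iff_index_eq)

lemma pos_inject:
  assumes "x \<in> set xs" "y \<in> set xs" "distinct xs"
  shows "pos xs x = pos xs y \<longleftrightarrow> x = y"
  using assms by (metis in_set_conv_nth pos_nth)

lemma pos_less_split:
  assumes "distinct (as @ i # bs)" "j \<in> set (as @ i # bs)"
  shows "pos (as @ i # bs) j < pos (as @ i # bs) i \<longleftrightarrow> j \<in> set as"
  using assms
proof (induction as)
  case Nil
  then show ?case by (auto simp: pos_Cons)
next
  case (Cons a as)
  then show ?case by (auto simp: pos_Cons)
qed

text \<open>A permutation of \<open>B\<close> carrying \<open>w\<close> to \<open>w'\<close>,
  extended by the identity, acts bijectively on the orders of \<open>A\<close> and commutes with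
  restriction to \<open>B\<close>.\<close>

lemma card_permutations_filter_eq:
  assumes "finite A" "B \<subseteq> A" "w \<in> permutations_of_set B" "w' \<in> permutations_of_set B"
  shows "card {\<pi> \<in> permutations_of_set A. filter (\<lambda>x. x \<in> B) \<pi> = w}
       = card {\<pi> \<in> permutations_of_set A. filter (\<lambda>x. x \<in> B) \<pi> = w'}"
proof -
  obtain f where f: "f permutes B" "map f w = w'"
  proof -
    have "w' \<in> permutations_of_set B" "w \<in> permutations_of_set B" by fact+
    then have d: "distinct w" "set w = B" "distinct w'" "set w' = B" "length w = length w'"
      by (auto simp: permutations_of_set_def distinct_card[symmetric])
    define f where "f x = (if x \<in> B then w' ! pos w x else x)" for x
    have m: "map f w = w'"
      by (rule nth_equalityI) (use d in \<open>auto simp: f_def pos_nth\<close>)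
    have "f ` B = B" using m d by (metis set_map)
    moreover have "finite B" using d by auto
    ultimately have "f permutes B"
      by (intro bij_imp_permutes) (auto simp: bij_betw_def f_def finite_surj_inj)
    then show ?thesis using that m by blast
  qed
  have fA: "f permutes A" using f(1) assms(2) by (rule permutes_subset)
  have comm: "filter (\<lambda>x. x \<in> B) (map f \<pi>) = map f (filter (\<lambda>x. x \<in> B) \<pi>)" for \<pi>
    using permutes_in_image[OF f(1)] by (induction \<pi>) auto
  have inj: "map f u = map f v \<longleftrightarrow> u = v" for u v
    using permutes_inj[OF f(1)] by (simp add: inj_map_eq_map)
  have "{\<pi> \<in> permutations_of_set A. filter (\<lambda>x. x \<in> B) \<pi> = w}
      = {\<pi> \<in> permutations_of_set A. filter (\<lambda>x. x \<in> B) (map f \<pi>) = w'}"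
    using f(2) inj by (auto simp: comm)
  then show ?thesis using card_permutations_map[OF fA, of "\<lambda>\<pi>. filter (\<lambda>x. x \<in> B) \<pi> = w'"] by simp
qed

text \<open>Given the relative order \<open>w\<close> of \<open>J\<close>, the position of \<open>i\<close> among \<open>J\<close> is uniform.\<close>

lemma card_permutations_rank_among_le:
  assumes "finite A" "i \<in> A" "J \<subseteq> A" "i \<notin> J" "w \<in> permutations_of_set J"
  shows "Suc (card J) * card {\<pi> \<in> permutations_of_set A. filter (\<lambda>x. x \<in> J) \<pi> = w \<and>
            card {j\<in>J. pos \<pi> j < pos \<pi> i} < q}
       \<le> q * card {\<pi> \<in> permutations_of_set A. filter (\<lambda>x. x \<in> J) \<pi> = w}"
proof -
  define m where "m = card J"
  have w: "distinct w" "set w = J" "length w = m"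
    using assms(5) by (auto simp: permutations_of_set_def m_def distinct_card[symmetric])
  \<comment> \<open>The orders inducing \<open>w\<close> on \<open>J\<close> are split into classes
    \<open>Z r\<close> by the rank \<open>r\<close> of \<open>i\<close> among \<open>J\<close>. The
    \<open>m + 1\<close> classes have a common size \<open>h\<close>, and at most \<open>q\<close>
    of them have \<open>r < q\<close>.\<close>
  define ins where "ins r = take r w @ i # drop r w" for r
  define Z where "Z r = {\<pi> \<in> permutations_of_set A. filter (\<lambda>x. x \<in> insert i J) \<pi> = ins r}" for r
  let ?X = "{\<pi> \<in> permutations_of_set A. filter (\<lambda>x. x \<in> J) \<pi> = w}"
  let ?rk = "\<lambda>\<pi>. card {j\<in>J. pos \<pi> j < pos \<pi> i}"
  have ins_perm: "ins r \<in> permutations_of_set (insert i J)" if "r \<le> m" for r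
  proof (rule permutations_of_setI)
    have "set (take r w) \<union> set (drop r w) = J" using w(2) by (metis append_take_drop_id set_append)
    then show "set (ins r) = insert i J" by (auto simp: ins_def)
    have "i \<notin> set w" using w(2) assms(4) by simp
    then show "distinct (ins r)" using w(1)
      by (auto simp: ins_def set_take_disj_set_drop_if_distinct dest: in_set_takeD in_set_dropD)
  qed
  define h where "h = card (Z 0)"
  have cZ: "card (Z r) = h" if "r \<le> m" for r
    unfolding Z_def h_def
    by (rule card_permutations_filter_eq) (use assms that ins_perm in auto)
  have XZ: "\<pi> \<in> Z (?rk \<pi>)" "?rk \<pi> \<le> m" if pX: "\<pi> \<in> ?X" for \<pi>
  proof -
    have p: "distinct \<pi>" "set \<pi> = A" "filter (\<lambda>x. x \<in> J) \<pi> = w" "\<pi> \<in> permutations_of_set A"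
      using pX by (auto simp: permutations_of_set_def)
    obtain as bs where s: "\<pi> = as @ i # bs" using assms(2) p(2) by (metis split_list)
    have ni: "i \<notin> set as" "i \<notin> set bs" using p(1) s by auto
    have "{j\<in>J. pos \<pi> j < pos \<pi> i} = {j\<in>J. j \<in> set as}"
      using pos_less_split[of as i bs] p(1,2) s assms(3) by auto
    also have "\<dots> = set (filter (\<lambda>x. x \<in> J) as)" by auto
    finally have r: "?rk \<pi> = length (filter (\<lambda>x. x \<in> J) as)"
      using p(1) s by (metis distinct_append distinct_card distinct_filter)
    have wq: "w = filter (\<lambda>x. x \<in> J) as @ filter (\<lambda>x. x \<in> J) bs" using p(3) s assms(4) by simp
    have f1: "filter (\<lambda>x. x = i \<or> x \<in> J) as = filter (\<lambda>x. x \<in> J) as"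
      "filter (\<lambda>x. x = i \<or> x \<in> J) bs = filter (\<lambda>x. x \<in> J) bs"
      using ni by (auto intro!: filter_cong)
    show "\<pi> \<in> Z (?rk \<pi>)" unfolding r Z_def ins_def using wq p(4) s f1 by simp
    show "?rk \<pi> \<le> m" unfolding r using wq w(3) by simp
  qed
  have ZX: "\<pi> \<in> ?X" if "\<pi> \<in> Z r" for \<pi> r
  proof -
    have "filter (\<lambda>x. x \<in> J) \<pi> = filter (\<lambda>x. x \<in> J) (filter (\<lambda>x. x \<in> insert i J) \<pi>)"
      by (auto intro!: filter_cong)
    also have "\<dots> = filter (\<lambda>x. x \<in> J) (ins r)" using that by (simp add: Z_def)
    also have "\<dots> = filter (\<lambda>x. x \<in> J) (take r w @ drop r w)"
      using assms(4) unfolding ins_def filter_append by simp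
    also have "\<dots> = w" using w(2) by simp
    finally show ?thesis using that by (simp add: Z_def)
  qed
  have rk: "?rk \<pi> = r" if "\<pi> \<in> Z r" "r \<le> m" for \<pi> r
  proof -
    have "ins (?rk \<pi>) = ins r" using XZ(1)[OF ZX[OF that(1)]] that by (simp add: Z_def)
    moreover have "i \<notin> set (take r w)" "i \<notin> set (drop r w)"
      using w(2) assms(4) by (auto dest: in_set_takeD in_set_dropD)
    ultimately have "take r w = take (?rk \<pi>) w" unfolding ins_def
      using append_Cons_eq_iff[of i "take r w" "drop r w" "take (?rk \<pi>) w" "drop (?rk \<pi>) w"] by simp
    then have "length (take r w) = length (take (?rk \<pi>) w)" by (rule arg_cong)
    then show ?thesis using XZ(2)[OF ZX[OF that(1)]] that(2) w(3) by simp
  qed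
  have disj: "card (\<Union>r\<in>R. Z r) = card R * h" if "R \<subseteq> {..m}" for R
  proof -
    have "card (\<Union>r\<in>R. Z r) = (\<Sum>r\<in>R. card (Z r))"
    proof (rule card_UN_disjoint)
      show "finite R" using that finite_subset by auto
      show "\<forall>r\<in>R. finite (Z r)" by (simp add: Z_def)
      show "\<forall>r\<in>R. \<forall>r'\<in>R. r \<noteq> r' \<longrightarrow> Z r \<inter> Z r' = {}" using rk that by blast
    qed
    also have "\<dots> = (\<Sum>r\<in>R. h)" by (rule sum.cong) (use cZ that in auto)
    finally show ?thesis by simp
  qed
  have "?X = (\<Union>r\<in>{..m}. Z r)" using XZ ZX by (auto simp del: mem_Collect_eq)
  then have cX: "card ?X = Suc m * h" using disj[of "{..m}"] by simp
  have "{\<pi> \<in> permutations_of_set A. filter (\<lambda>x. x \<in> J) \<pi> = w \<and> ?rk \<pi> < q} = {\<pi>\<in>?X. ?rk \<pi> < q}" by auto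
  also have "\<dots> = (\<Union>r\<in>{r. r \<le> m \<and> r < q}. Z r)" (is "?Y = ?U")
  proof
    show "?Y \<subseteq> ?U" using XZ by blast
    show "?U \<subseteq> ?Y" using ZX rk by blast
  qed
  also have "card \<dots> = card {r. r \<le> m \<and> r < q} * h" by (rule disj) auto
  also have "\<dots> \<le> q * h" using card_mono[of "{..<q}" "{r. r \<le> m \<and> r < q}"] by auto
  finally show ?thesis unfolding cX m_def[symmetric]
    using mult_le_mono2[of _ "q * h" "Suc m"] by (simp only: mult.left_commute)
qed

text \<open>Here the comparison set depends on the order itself, but by \<open>loc\<close> it is
  determined by the order within that set. Conditioning on the set and its induced order therefore
  reveals nothing about where \<open>i\<close> stands, and the fixed-set bound applies class by
  class.\<close>

lemma card_permutations_rank_among_adaptive_le: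
  assumes "finite A" "i \<in> A"
    and J: "\<And>\<pi>. \<pi> \<in> permutations_of_set A \<Longrightarrow> J \<pi> \<subseteq> A - {i}"
    and loc: "\<And>\<pi> \<pi>'. \<pi> \<in> permutations_of_set A \<Longrightarrow> \<pi>' \<in> permutations_of_set A \<Longrightarrow>
       filter (\<lambda>x. x \<in> J \<pi>) \<pi>' = filter (\<lambda>x. x \<in> J \<pi>) \<pi> \<Longrightarrow> J \<pi>' = J \<pi>"
  shows "Suc M * card {\<pi> \<in> permutations_of_set A. M \<le> card (J \<pi>) \<and>
            card {j\<in>J \<pi>. pos \<pi> j < pos \<pi> i} < q}
       \<le> q * card (permutations_of_set A)"
proof -
  let ?P = "permutations_of_set A"
  let ?Q = "\<lambda>\<pi>. M \<le> card (J \<pi>) \<and> card {j\<in>J \<pi>. pos \<pi> j < pos \<pi> i} < q"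
  define key where "key \<pi> = (J \<pi>, filter (\<lambda>x. x \<in> J \<pi>) \<pi>)" for \<pi>
  have fib: "Suc M * card {\<pi>\<in>?P. key \<pi> = y \<and> ?Q \<pi>} \<le> q * card {\<pi>\<in>?P. key \<pi> = y}"
    if y: "y \<in> key ` ?P" for y
  proof -
    obtain \<pi>0 where p0: "\<pi>0 \<in> ?P" "y = key \<pi>0" using y by auto
    define J0 where "J0 = J \<pi>0"
    define w where "w = filter (\<lambda>x. x \<in> J0) \<pi>0"
    \<comment> \<open>By \<open>loc\<close> the class of \<open>\<pi>0\<close> is cut out by the
      induced order on \<open>J0\<close> alone; no further condition on \<open>J \<pi>\<close>
      remains.\<close>
    have cls: "key \<pi> = y \<longleftrightarrow> filter (\<lambda>x. x \<in> J0) \<pi> = w" if "\<pi> \<in> ?P" for \<pi>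
      using loc[OF p0(1) that] p0 by (auto simp: key_def J0_def w_def)
    have J0: "J \<pi> = J0" if "\<pi> \<in> ?P" "filter (\<lambda>x. x \<in> J0) \<pi> = w" for \<pi>
      using loc[OF p0(1) that(1)] that(2) by (auto simp: J0_def w_def)
    have sub: "J0 \<subseteq> A - {i}" using J[OF p0(1)] by (simp add: J0_def)
    have w: "w \<in> permutations_of_set J0"
      using p0(1) sub by (auto simp: w_def permutations_of_set_def)
    have e1: "{\<pi>\<in>?P. key \<pi> = y} = {\<pi>\<in>?P. filter (\<lambda>x. x \<in> J0) \<pi> = w}" using cls by auto
    show ?thesis
    proof (cases "M \<le> card J0")
      case True
      have "{\<pi>\<in>?P. key \<pi> = y \<and> ?Q \<pi>} = {\<pi>\<in>?P. filter (\<lambda>x. x \<in> J0) \<pi> = w \<and>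
            card {j\<in>J0. pos \<pi> j < pos \<pi> i} < q}"
        using cls J0 True by auto
      moreover have "Suc M \<le> Suc (card J0)" using True by simp
      ultimately have le: "Suc M * card {\<pi>\<in>?P. key \<pi> = y \<and> ?Q \<pi>}
          \<le> Suc (card J0) * card {\<pi>\<in>?P. filter (\<lambda>x. x \<in> J0) \<pi> = w \<and>
            card {j\<in>J0. pos \<pi> j < pos \<pi> i} < q}" by (simp only: mult_le_mono1)
      show ?thesis unfolding e1
      proof (rule le_trans[OF le], rule card_permutations_rank_among_le)
        show "finite A" "i \<in> A" by fact+
        show "J0 \<subseteq> A" "i \<notin> J0" using sub by blast+
        show "w \<in> permutations_of_set J0" by fact
      qed
    next
      case False
      then have "{\<pi>\<in>?P. key \<pi> = y \<and> ?Q \<pi>} = {}" using cls J0 by auto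
      then show ?thesis by (simp only: card.empty mult_0_right zero_le)
    qed
  qed
  have "card {\<pi>\<in>?P. ?Q \<pi>} = (\<Sum>y\<in>key ` {\<pi>\<in>?P. ?Q \<pi>}. card {\<pi>\<in>{\<pi>\<in>?P. ?Q \<pi>}. key \<pi> = y})"
    by (rule card_eq_sum_fibres) simp
  also have "\<dots> \<le> (\<Sum>y\<in>key ` ?P. card {\<pi>\<in>{\<pi>\<in>?P. ?Q \<pi>}. key \<pi> = y})"
    by (rule sum_mono2) auto
  also have "\<dots> = (\<Sum>y\<in>key ` ?P. card {\<pi>\<in>?P. key \<pi> = y \<and> ?Q \<pi>})"
    by (intro sum.cong arg_cong[where f=card]) auto
  finally have "Suc M * card {\<pi>\<in>?P. ?Q \<pi>} \<le> Suc M * (\<Sum>y\<in>key ` ?P. card {\<pi>\<in>?P. key \<pi> = y \<and> ?Q \<pi>})"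
    by (rule mult_le_mono2)
  also have "\<dots> = (\<Sum>y\<in>key ` ?P. Suc M * card {\<pi>\<in>?P. key \<pi> = y \<and> ?Q \<pi>})"
    by (rule sum_distrib_left)
  also have "\<dots> \<le> (\<Sum>y\<in>key ` ?P. q * card {\<pi>\<in>?P. key \<pi> = y})"
    by (rule sum_mono) (rule fib)
  also have "\<dots> = q * card ?P"
    using card_eq_sum_fibres[of ?P key] by (simp add: sum_distrib_left)
  finally show ?thesis .
qed

subsection \<open>Deferred acceptance\<close>

lemma bij_betw_rank:
  fixes key :: "'a \<Rightarrow> nat"
  assumes "finite D" "inj_on key D"
  shows "bij_betw (\<lambda>x. card {y\<in>D. key y < key x}) D {..<card D}"
proof -
  let ?r = "\<lambda>x. card {y\<in>D. key y < key x}"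
  have less: "?r x < ?r y" if "x \<in> D" "y \<in> D" "key x < key y" for x y
    by (rule psubset_card_mono) (use assms that in auto)
  have inj: "inj_on ?r D"
  proof (rule inj_onI)
    fix x y assume xy: "x \<in> D" "y \<in> D" "?r x = ?r y"
    then have "key x = key y" using less[of x y] less[of y x] by (metis nat_neq_iff)
    then show "x = y" using assms(2) xy by (simp add: inj_on_def)
  qed
  have "?r x < card D" if "x \<in> D" for x
    by (rule psubset_card_mono) (use assms that in auto)
  then have "?r ` D \<subseteq> {..<card D}" by auto
  moreover have "card (?r ` D) = card {..<card D}" using inj by (simp add: card_image)
  ultimately have "?r ` D = {..<card D}" by (intro card_subset_eq) auto
  then show ?thesis using inj by (simp add: bij_betw_def)
qed

text \<open>Ranks under an injective key run through an initial segment of the naturals. With the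
  key \<open>pos\<close> this counts the applicants that a school keeps.\<close>

lemma card_rank_less:
  fixes key :: "'a \<Rightarrow> nat"
  assumes "finite D" "inj_on key D"
  shows "card {x\<in>D. card {y\<in>D. key y < key x} < q} = min q (card D)"
proof -
  let ?r = "\<lambda>x. card {y\<in>D. key y < key x}"
  have b: "bij_betw ?r D {..<card D}" using assms by (rule bij_betw_rank)
  have img: "?r ` {x\<in>D. ?r x < q} = {..<min q (card D)}"
  proof
    show "?r ` {x\<in>D. ?r x < q} \<subseteq> {..<min q (card D)}"
      using bij_betw_imp_surj_on[OF b] by auto
    show "{..<min q (card D)} \<subseteq> ?r ` {x\<in>D. ?r x < q}"
    proof
      fix u assume u: "u \<in> {..<min q (card D)}"
      then obtain x where "x \<in> D" "u = ?r x" using bij_betw_imp_surj_on[OF b] by (auto simp: image_iff set_eq_iff)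
      then show "u \<in> ?r ` {x\<in>D. ?r x < q}" using u by auto
    qed
  qed
  have "inj_on ?r {x\<in>D. ?r x < q}"
    using bij_betw_imp_inj_on[OF b] by (rule inj_on_subset) auto
  from card_image[OF this] show ?thesis unfolding img by simp
qed

lemma instances_prefsD:
  assumes "P \<in> instances n q" "i < n * q"
  shows "distinct (fst P i)" "set (fst P i) = {0..<n}" "length (fst P i) = n"
proof -
  have "fst P i \<in> permutations_of_set {0..<n}" using assms by (auto simp: instances_def)
  then show "distinct (fst P i)" "set (fst P i) = {0..<n}" "length (fst P i) = n"
    by (auto simp: permutations_of_set_def distinct_card[symmetric])
qed

lemma instances_nth_less:
  assumes "P \<in> instances n q" "i < n * q" "m < n"
  shows "fst P i ! m < n"
  using instances_prefsD[OF assms(1,2)] nth_mem[of m "fst P i"] assms(3) by simp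

lemma instances_pos_inj:
  assumes "P \<in> instances n q" "s < n"
  shows "inj_on (pos (snd P s)) {0..<n * q}"
proof -
  have "snd P s \<in> permutations_of_set {0..<n * q}" using assms by (auto simp: instances_def)
  then show ?thesis by (auto simp: permutations_of_set_def inj_on_def pos_inject)
qed

abbreviation beating :: "nat \<Rightarrow> nat \<Rightarrow> sc_instance \<Rightarrow> (nat \<Rightarrow> nat) \<Rightarrow> nat \<Rightarrow> nat \<Rightarrow> nat set" where
  "beating n q P k s i \<equiv> {j \<in> applicants n q P k s. pos (snd P s) j < pos (snd P s) i}"

text \<open>Invariant of the rounds: every past rejection is still supported by the present
  applicants. An exhausted list, \<open>k i = n\<close>, is allowed here and is excluded only for
  the final state.\<close>

definition justified :: "nat \<Rightarrow> nat \<Rightarrow> sc_instance \<Rightarrow> (nat \<Rightarrow> nat) \<Rightarrow> bool" where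
  "justified n q P k \<longleftrightarrow> (\<forall>i<n * q. k i \<le> n \<and> (\<forall>m<k i. q \<le> card (beating n q P k (fst P i ! m) i)))"

lemma finite_applicants [simp]: "finite (applicants n q P k s)"
  by (simp add: applicants_def)

text \<open>The \<open>q\<close> highest applicants ahead of \<open>i\<close> are not rejected in
  this round, so they apply to the same school in the next one.\<close>

lemma card_beating_da_step:
  assumes P: "P \<in> instances n q" and "s < n" and le: "q \<le> card (beating n q P k s i)"
  shows "q \<le> card (beating n q P (da_step n q P k) s i)"
proof -
  let ?D = "beating n q P k s i" and ?key = "pos (snd P s)"
  have "inj_on ?key ?D"
    using instances_pos_inj[OF P assms(2)] by (rule inj_on_subset) (auto simp: applicants_def)
  then have "card {x\<in>?D. card {y\<in>?D. ?key y < ?key x} < q} = min q (card ?D)"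
    by (intro card_rank_less) auto
  then have "q \<le> card {x\<in>?D. card {y\<in>?D. ?key y < ?key x} < q}" using le by simp
  also have "\<dots> \<le> card (beating n q P (da_step n q P k) s i)"
  proof (rule card_mono)
    show "{x\<in>?D. card {y\<in>?D. ?key y < ?key x} < q} \<subseteq> beating n q P (da_step n q P k) s i"
    proof
      fix x assume x: "x \<in> {x\<in>?D. card {y\<in>?D. ?key y < ?key x} < q}"
      \<comment> \<open>Whoever is ahead of \<open>x\<close> is also ahead of \<open>i\<close>, so
        restricting to \<open>?D\<close> loses no competitor of \<open>x\<close>.\<close>
      then have "{y\<in>?D. ?key y < ?key x} = beating n q P k s x" by auto
      then have "\<not> rejected n q P k x" using x by (auto simp: rejected_def Let_def applicants_def)
      then show "x \<in> beating n q P (da_step n q P k) s i" using x by (auto simp: applicants_def da_step_def)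
    qed
  qed simp
  finally show ?thesis .
qed

lemma justified_da_step:
  assumes P: "P \<in> instances n q" and k: "justified n q P k"
  shows "justified n q P (da_step n q P k)"
  unfolding justified_def
proof (intro allI impI conjI)
  fix i assume i: "i < n * q"
  show "da_step n q P k i \<le> n"
    using k i by (auto simp: justified_def da_step_def rejected_def)
  fix m assume m: "m < da_step n q P k i"
  have mn: "m < n" using m \<open>da_step n q P k i \<le> n\<close> by simp
  then have "fst P i ! m < n" by (rule instances_nth_less[OF P i])
  moreover have "q \<le> card (beating n q P k (fst P i ! m) i)"
  proof (cases "m < k i")
    case True
    then show ?thesis using k i by (simp add: justified_def)
  next
    case False
    then have "rejected n q P k i" "m = k i" using m by (auto simp: da_step_def split: if_splits)
    then show ?thesis by (simp add: rejected_def Let_def)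
  qed
  ultimately show "q \<le> card (beating n q P (da_step n q P k) (fst P i ! m) i)"
    by (rule card_beating_da_step[OF P])
qed

lemma justified_da_iterate:
  assumes "P \<in> instances n q"
  shows "justified n q P ((da_step n q P ^^ t) (\<lambda>_. 0))"
proof (induction t)
  case 0
  then show ?case by (simp add: justified_def)
next
  case (Suc t)
  then show ?case using justified_da_step[OF assms] by simp
qed

text \<open>Every round that changes the state raises the total number of rejections. Since that
  total stays at most \<open>n * n * q\<close>, the number of rounds in \<open>da_state\<close>
  suffices to reach a fixed point.\<close>

lemma da_iterate_fixed_or_sum:
  fixes n q P
  defines "k \<equiv> \<lambda>t. (da_step n q P ^^ t) (\<lambda>_. 0)"
  shows "da_step n q P (k t) = k t \<or> t \<le> (\<Sum>i<n * q. k t i)"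
proof (induction t)
  case 0
  then show ?case by simp
next
  case (Suc t)
  have S: "k (Suc t) = da_step n q P (k t)" by (simp add: k_def)
  show ?case
  proof (cases "da_step n q P (k t) = k t")
    case True
    then show ?thesis using S by simp
  next
    case False
    then have ih: "t \<le> (\<Sum>i<n * q. k t i)" using Suc by simp
    obtain i where i: "rejected n q P (k t) i" using False by (auto simp: da_step_def fun_eq_iff split: if_splits)
    have "(\<Sum>i<n * q. k t i) < (\<Sum>i<n * q. k (Suc t) i)"
      by (rule sum_strict_mono_ex1) (use i in \<open>auto simp: S da_step_def rejected_def\<close>)
    then show ?thesis using ih by simp
  qed
qed

lemma justified_da_state:
  assumes "P \<in> instances n q"
  shows "justified n q P (da_state n q P)"
  unfolding da_state_def using assms by (rule justified_da_iterate)

lemma da_state_not_rejected: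
  assumes "P \<in> instances n q"
  shows "\<not> rejected n q P (da_state n q P) i"
proof -
  let ?k = "da_state n q P"
  have "(\<Sum>i<n * q. ?k i) \<le> (\<Sum>i<n * q. n)"
    using justified_da_state[OF assms] by (intro sum_mono) (auto simp: justified_def)
  also have "\<dots> < n * n * q + 1" by simp
  finally have "da_step n q P ?k = ?k"
    using da_iterate_fixed_or_sum[of n q P "n * n * q + 1"] unfolding da_state_def by linarith
  then have "da_step n q P ?k i = ?k i" by simp
  then show ?thesis by (auto simp: da_step_def)
qed

text \<open>A student with an exhausted list would have been rejected everywhere, so all
  \<open>n\<close> schools would have \<open>q\<close> applicants each; these are disjoint groups
  among the other \<open>n * q - 1\<close> students.\<close>

lemma da_state_less:
  assumes P: "P \<in> instances n q" and i: "i < n * q"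
  shows "da_state n q P i < n"
proof (rule ccontr)
  let ?k = "da_state n q P"
  assume "\<not> ?k i < n"
  then have ki: "?k i = n" using justified_da_state[OF P] i by (auto simp: justified_def)
  have ge: "q \<le> card (applicants n q P ?k s)" if s: "s < n" for s
  proof -
    obtain m where "m < n" "fst P i ! m = s"
      using instances_prefsD[OF P i] s by (metis atLeastLessThan_iff in_set_conv_nth zero_le)
    then have "q \<le> card (beating n q P ?k s i)"
      using justified_da_state[OF P] i ki by (auto simp: justified_def)
    also have "\<dots> \<le> card (applicants n q P ?k s)" by (rule card_mono) auto
    finally show ?thesis .
  qed
  have "n * q = (\<Sum>s<n. q)" by simp
  also have "\<dots> \<le> (\<Sum>s<n. card (applicants n q P ?k s))" using ge by (intro sum_mono) auto
  also have "\<dots> = card (\<Union>s<n. applicants n q P ?k s)"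
    by (rule card_UN_disjoint[symmetric]) (auto simp: applicants_def)
  also have "\<dots> \<le> card ({0..<n * q} - {i})"
    by (rule card_mono) (use ki in \<open>auto simp: applicants_def\<close>)
  also have "\<dots> < n * q" using i by simp
  finally show False by simp
qed

lemma DA_less:
  assumes P: "P \<in> instances n q" and i: "i < n * q"
  shows "DA n q P i < n"
  unfolding DA_def by (rule instances_nth_less[OF P i da_state_less[OF P i]])

text \<open>In the final state nobody is rejected, so every applicant of \<open>s\<close> has rank
  below \<open>q\<close> among them.\<close>

lemma card_DA_preimage_le:
  assumes P: "P \<in> instances n q" and s: "s < n"
  shows "card {i \<in> {0..<n * q}. DA n q P i = s} \<le> q"
proof -
  let ?X = "applicants n q P (da_state n q P) s" and ?key = "pos (snd P s)"
  have X: "{i \<in> {0..<n * q}. DA n q P i = s} = ?X"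
    using da_state_less[OF P] by (auto simp: applicants_def DA_def)
  have "card {y\<in>?X. ?key y < ?key x} < q" if "x \<in> ?X" for x
  proof -
    have "\<not> rejected n q P (da_state n q P) x" by (rule da_state_not_rejected[OF P])
    then show ?thesis using that by (auto simp: rejected_def applicants_def Let_def)
  qed
  then have top: "{x\<in>?X. card {y\<in>?X. ?key y < ?key x} < q} = ?X" by auto
  have "inj_on ?key ?X"
    using instances_pos_inj[OF P s] by (rule inj_on_subset) (auto simp: applicants_def)
  then have "card {x\<in>?X. card {y\<in>?X. ?key y < ?key x} < q} = min q (card ?X)"
    by (intro card_rank_less finite_applicants)
  then have "card ?X = min q (card ?X)" unfolding top .
  then show ?thesis unfolding X by linarith
qed

text \<open>The rejection count of \<open>i\<close> is the position of her own school in her list,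
  so the prefix of that length consists of the schools she prefers to it.\<close>

lemma not_envy_DA_notin_prefix:
  assumes P: "P \<in> instances n q" and ij: "i < n * q" "j < n * q" and "\<not> envy n q P i j"
  shows "DA n q P j \<notin> set (take (da_state n q P i) (fst P i))"
proof
  let ?k = "da_state n q P i"
  assume "DA n q P j \<in> set (take ?k (fst P i))"
  then obtain m where m: "m < ?k" "m < length (fst P i)" "fst P i ! m = DA n q P j"
    by (auto simp: in_set_conv_nth)
  have "pos (fst P i) (DA n q P j) = m"
    using pos_nth[of "fst P i" m] instances_prefsD[OF P ij(1)] m by simp
  moreover have "pos (fst P i) (DA n q P i) = ?k"
    using pos_nth[of "fst P i" ?k] instances_prefsD[OF P ij(1)] da_state_less[OF P ij(1)]
    by (simp add: DA_def)
  ultimately show False using assms(4) m ij by (simp add: envy_def)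
qed

subsection \<open>Sequential deferred acceptance\<close>

text \<open>Student-proposing deferred acceptance run without student \<open>i\<^sub>0\<close>, one application at a time,
where the least student allowed to apply moves next and nobody applies more than \<open>L\<close> times. The
state \<open>c\<close> counts the applications made so far, so \<open>c j\<close> is one more than the number of
rejections of a student \<open>j\<close> who is applying; \<open>applied\<close> lists the schools applied to.\<close>

locale sequential_da =
  fixes N L q i\<^sub>0 :: nat
begin

text \<open>The latest school applied to stands at index \<open>c i - 1\<close>, and
  \<open>c i = 0\<close> means that the student has not entered yet. Only the current applicants of
  that school are compared, as in a round of deferred acceptance.\<close>

definition pending :: "(nat \<Rightarrow> nat list) \<Rightarrow> (nat \<Rightarrow> nat list) \<Rightarrow> (nat \<Rightarrow> nat) \<Rightarrow> nat \<Rightarrow> bool" where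
  "pending f g c i \<longleftrightarrow> i < N \<and> i \<noteq> i\<^sub>0 \<and> c i < L \<and>
     (c i = 0 \<or> q \<le> card {j. j < N \<and> j \<noteq> i\<^sub>0 \<and> 0 < c j \<and> f j ! (c j - 1) = f i ! (c i - 1) \<and>
        pos (g (f i ! (c i - 1))) j < pos (g (f i ! (c i - 1))) i})"

definition mover :: "(nat \<Rightarrow> nat list) \<Rightarrow> (nat \<Rightarrow> nat list) \<Rightarrow> (nat \<Rightarrow> nat) \<Rightarrow> nat" where
  "mover f g c = (LEAST i. pending f g c i)"

definition stuck :: "(nat \<Rightarrow> nat list) \<Rightarrow> (nat \<Rightarrow> nat list) \<Rightarrow> (nat \<Rightarrow> nat) \<Rightarrow> bool" where
  "stuck f g c \<longleftrightarrow> (\<forall>i. \<not> pending f g c i)"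

primrec counts :: "(nat \<Rightarrow> nat list) \<Rightarrow> (nat \<Rightarrow> nat list) \<Rightarrow> nat \<Rightarrow> nat \<Rightarrow> nat" where
  "counts f g 0 = (\<lambda>_. 0)"
| "counts f g (Suc t) = (let c = counts f g t in
     if stuck f g c then c else c(mover f g c := Suc (c (mover f g c))))"

primrec applied :: "(nat \<Rightarrow> nat list) \<Rightarrow> (nat \<Rightarrow> nat list) \<Rightarrow> nat \<Rightarrow> nat list" where
  "applied f g 0 = []"
| "applied f g (Suc t) = (let c = counts f g t in
     if stuck f g c then applied f g t else applied f g t @ [f (mover f g c) ! c (mover f g c)])"

text \<open>This records everyone who has applied to \<open>s\<close> so far, including those
  rejected since. It is the comparison set for the rank of \<open>i\<^sub>0\<close>.\<close>

definition proposers :: "(nat \<Rightarrow> nat list) \<Rightarrow> (nat \<Rightarrow> nat list) \<Rightarrow> nat \<Rightarrow> nat \<Rightarrow> nat set" where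
  "proposers f g t s = {j. j < N \<and> s \<in> set (take (counts f g t j) (f j))}"

lemma pending_mover:
  assumes "\<not> stuck f g c"
  shows "pending f g c (mover f g c)"
  using assms unfolding stuck_def mover_def by (auto intro: LeastI)

lemma counts_le: "counts f g t j \<le> L"
proof (induction t)
  case (Suc t)
  show ?case using Suc pending_mover[of f g "counts f g t"] by (auto simp: Let_def pending_def)
qed simp

lemma counts_outside:
  assumes "j = i\<^sub>0 \<or> N \<le> j"
  shows "counts f g t j = 0"
proof (induction t)
  case (Suc t)
  show ?case using Suc assms pending_mover[of f g "counts f g t"]
    by (cases "stuck f g (counts f g t)") (auto simp: Let_def pending_def)
qed simp

lemma counts_mono_Suc: "counts f g t j \<le> counts f g (Suc t) j"
  by (simp add: Let_def)

lemma counts_mono: "t \<le> T \<Longrightarrow> counts f g t j \<le> counts f g T j"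
  using lift_Suc_mono_le[of "\<lambda>t. counts f g t j"] counts_mono_Suc by blast

lemma proposers_mono: "t \<le> T \<Longrightarrow> proposers f g t s \<subseteq> proposers f g T s"
proof
  fix j assume t: "t \<le> T" and "j \<in> proposers f g t s"
  then show "j \<in> proposers f g T s"
    using set_take_subset_set_take[OF counts_mono[OF t, of f g j], of "f j"]
    by (auto simp: proposers_def)
qed

lemma finite_proposers [simp]: "finite (proposers f g t s)"
  by (simp add: proposers_def)

lemma proposers_subset: "proposers f g t s \<subseteq> {0..<N} - {i\<^sub>0}"
  by (auto simp: proposers_def counts_outside)

lemma length_applied: "length (applied f g t) = (\<Sum>j<N. counts f g t j)"
proof (induction t)
  case (Suc t)
  let ?c = "counts f g t"
  show ?case
  proof (cases "stuck f g ?c")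
    case False
    let ?i = "mover f g ?c"
    have "?i < N" using pending_mover[OF False] by (simp add: pending_def)
    then have "(\<Sum>j<N. (?c(?i := Suc (?c ?i))) j) = Suc (\<Sum>j<N. ?c j)"
      by (subst (1 2) sum.remove[of _ ?i]) auto
    then show ?thesis using False Suc by (simp add: Let_def)
  qed (use Suc in simp)
qed simp

lemma stuck_stays:
  assumes "stuck f g (counts f g t)" "t \<le> T"
  shows "counts f g T = counts f g t" "applied f g T = applied f g t"
  using assms(2)
proof (induction T rule: dec_induct)
  case (step T)
  { case 1 then show ?case using step assms(1) by (simp add: Let_def) }
  { case 2 then show ?case using step assms(1) by (simp add: Let_def) }
qed simp_all

lemma length_applied_not_stuck:
  assumes "\<not> stuck f g (counts f g t)" "u \<le> Suc t"
  shows "length (applied f g u) = u"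
  using assms(2)
proof (induction u)
  case (Suc u)
  have "\<not> stuck f g (counts f g u)" using stuck_stays(1)[of f g u t] assms(1) Suc.prems by auto
  then show ?case using Suc by (simp add: Let_def)
qed simp

lemma length_applied_le: "length (applied f g t) \<le> t"
  by (induction t) (auto simp: Let_def)

lemma take_applied:
  assumes "t \<le> T"
  shows "take t (applied f g T) = applied f g t"
  using assms
proof (induction T rule: dec_induct)
  case base
  then show ?case using length_applied_le by simp
next
  case (step T)
  show ?case
  proof (cases "stuck f g (counts f g T)")
    case True
    then show ?thesis using step by (simp add: Let_def)
  next
    case False
    then have "length (applied f g T) = T" by (intro length_applied_not_stuck) auto
    then show ?thesis using step False by (simp add: Let_def)
  qed
qed

text \<open>A step that does not lengthen the record happens only in a stuck state, and a stuck run
  stays as it is. So a short record shows by its length when the run stopped.\<close>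

lemma stuck_at_length_applied:
  assumes "length (applied f g T) < T"
  shows "stuck f g (counts f g (length (applied f g T)))"
proof (rule ccontr)
  let ?u = "length (applied f g T)"
  assume "\<not> stuck f g (counts f g ?u)"
  then have "length (applied f g (Suc ?u)) = Suc ?u" by (rule length_applied_not_stuck) simp
  moreover have "applied f g (Suc ?u) = take (Suc ?u) (applied f g T)"
    using assms by (intro take_applied[symmetric]) simp
  ultimately show False by simp
qed

text \<open>Deferred decisions: whether a student may move depends only on the list entries read so
  far.\<close>

lemma pending_cong:
  assumes "\<And>j. j < N \<Longrightarrow> take (c j) (f j) = take (c j) (f' j)"
  shows "pending f g c i \<longleftrightarrow> pending f' g c i"
proof -
  have e: "f j ! (c j - 1) = f' j ! (c j - 1)" if "j < N" "0 < c j" for j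
    using assms[OF that(1)] that(2) by (metis diff_less less_one nth_take)
  show ?thesis
  proof (cases "i < N \<and> 0 < c i")
    case True
    then have "{j. j < N \<and> j \<noteq> i\<^sub>0 \<and> 0 < c j \<and> f j ! (c j - 1) = f i ! (c i - 1) \<and>
        pos (g (f i ! (c i - 1))) j < pos (g (f i ! (c i - 1))) i}
      = {j. j < N \<and> j \<noteq> i\<^sub>0 \<and> 0 < c j \<and> f' j ! (c j - 1) = f' i ! (c i - 1) \<and>
        pos (g (f' i ! (c i - 1))) j < pos (g (f' i ! (c i - 1))) i}"
      using e by auto
    then show ?thesis unfolding pending_def by simp
  qed (auto simp: pending_def)
qed

text \<open>The record can be decoded step by step: the entries already read determine the next
  mover, and the next letter of the record is the next entry of her list.\<close>

lemma applied_determines_prefixes: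
  assumes "applied f g T = applied f' g T"
    and len: "\<forall>j<N. L \<le> length (f j)" "\<forall>j<N. L \<le> length (f' j)"
    and "t \<le> T"
  shows "counts f g t = counts f' g t \<and>
    (\<forall>j<N. take (counts f g t j) (f j) = take (counts f g t j) (f' j))"
  using assms(4)
proof (induction t)
  case (Suc t)
  let ?c = "counts f g t"
  have ih: "?c = counts f' g t" "\<And>j. j < N \<Longrightarrow> take (?c j) (f j) = take (?c j) (f' j)"
    using Suc by auto
  have pend: "pending f g ?c i = pending f' g ?c i" for i using ih(2) by (rule pending_cong)
  then have st: "stuck f g ?c = stuck f' g ?c" and mv: "mover f g ?c = mover f' g ?c"
    by (simp_all add: stuck_def mover_def)
  show ?case
  proof (cases "stuck f g ?c")
    case True
    then show ?thesis using st ih by (simp add: Let_def)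
  next
    case False
    let ?i = "mover f g ?c"
    have i: "?i < N" "?c ?i < L" using pending_mover[OF False] by (auto simp: pending_def)
    have "applied f g (Suc t) = applied f' g (Suc t)" "applied f g t = applied f' g t"
      using take_applied[OF Suc.prems] take_applied[of t T] Suc.prems assms(1)
      by (metis, metis Suc_leD)
    then have "f ?i ! ?c ?i = f' ?i ! ?c ?i" using False st mv ih(1) by (simp add: Let_def)
    moreover have "?c ?i < length (f ?i)" "?c ?i < length (f' ?i)"
      using len i by (meson less_le_trans)+
    ultimately have "take (Suc (?c ?i)) (f ?i) = take (Suc (?c ?i)) (f' ?i)"
      using ih(2)[OF i(1)] by (simp add: take_Suc_conv_app_nth)
    then show ?thesis using False st mv ih by (simp add: Let_def)
  qed
qed simp

text \<open>If the first run stops early, the second run has read the same entries by that time and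
  is stuck as well, so its record cannot continue.\<close>

lemma applied_prefix_free:
  assumes "take (length (applied f g T)) (applied f' g T) = applied f g T"
    and len: "\<forall>j<N. L \<le> length (f j)" "\<forall>j<N. L \<le> length (f' j)"
  shows "applied f' g T = applied f g T"
proof (cases "length (applied f g T) < T")
  case False
  then show ?thesis using assms(1) length_applied_le[of f' g T] by simp
next
  case True
  let ?u = "length (applied f g T)"
  have eq: "applied f g ?u = applied f' g ?u"
    using take_applied[of ?u T f g] take_applied[of ?u T f' g] True assms(1) by simp
  have st: "stuck f g (counts f g ?u)" using True by (rule stuck_at_length_applied)
  have d: "counts f g ?u = counts f' g ?u"
    "\<And>j. j < N \<Longrightarrow> take (counts f g ?u j) (f j) = take (counts f g ?u j) (f' j)"
    using applied_determines_prefixes[OF eq len order_refl] by auto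
  have "stuck f' g (counts f' g ?u)"
    using st pending_cong[OF d(2)] d(1) by (simp add: stuck_def)
  then have "applied f' g T = applied f' g ?u" using True by (intro stuck_stays) auto
  also have "\<dots> = applied f g T" using eq take_applied[of ?u T f g] True by simp
  finally show ?thesis .
qed

text \<open>Lists are distinct, so no student applies to a school twice and each occurrence of
  \<open>s\<close> comes from a new proposer.\<close>

lemma count_applied:
  assumes "\<forall>j<N. L \<le> length (f j)" "\<forall>j<N. distinct (f j)"
  shows "count_list (applied f g t) s = card (proposers f g t s)"
proof (induction t)
  case (Suc t)
  let ?c = "counts f g t"
  show ?case
  proof (cases "stuck f g ?c")
    case True
    then show ?thesis using Suc by (simp add: Let_def proposers_def)
  next
    case False
    let ?i = "mover f g ?c"
    have i: "?i < N" "?c ?i < L" using pending_mover[OF False] by (auto simp: pending_def)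
    then have l: "?c ?i < length (f ?i)" using assms(1) by (meson less_le_trans)
    have cS: "counts f g (Suc t) = ?c(?i := Suc (?c ?i))" using False by (simp add: Let_def)
    have tk: "take (Suc (?c ?i)) (f ?i) = take (?c ?i) (f ?i) @ [f ?i ! ?c ?i]"
      using l by (rule take_Suc_conv_app_nth)
    have "distinct (take (Suc (?c ?i)) (f ?i))" using assms(2) i(1) by simp
    then have nin: "f ?i ! ?c ?i \<notin> set (take (?c ?i) (f ?i))" unfolding tk by simp
    have P: "proposers f g (Suc t) s = (if s = f ?i ! ?c ?i then insert ?i (proposers f g t s)
       else proposers f g t s)"
      using i(1) tk unfolding proposers_def cS by (auto split: if_splits)
    have "?i \<notin> proposers f g t (f ?i ! ?c ?i)" using nin by (simp add: proposers_def)
    then show ?thesis using Suc False P by (simp add: Let_def)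
  qed
qed (simp add: proposers_def)

lemma in_set_applied_iff:
  assumes "\<forall>j<N. L \<le> length (f j)" "\<forall>j<N. distinct (f j)"
  shows "s \<in> set (applied f g t) \<longleftrightarrow> (\<exists>j<N. s \<in> set (take (counts f g t j) (f j)))"
proof -
  have "s \<in> set (applied f g t) \<longleftrightarrow> card (proposers f g t s) \<noteq> 0"
    using count_applied[OF assms, of g t s] by (metis count_list_0_iff)
  also have "\<dots> \<longleftrightarrow> (\<exists>j<N. s \<in> set (take (counts f g t j) (f j)))"
    by (auto simp: proposers_def)
  finally show ?thesis .
qed

text \<open>If the run stops early, few students are exhausted, and every school holds at most \<open>q\<close> of
the others, so almost all schools have been reached.\<close>

lemma stuck_covers:
  assumes len: "\<forall>j<N. L \<le> length (f j)" and dist: "\<forall>j<N. distinct (f j)"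
    and inj: "\<forall>j<N. \<forall>s\<in>set (f j). inj_on (pos (g s)) {0..<N}"
    and st: "length (applied f g T) < T"
  shows "L * N \<le> L + T + L * q * card (set (applied f g T))"
proof -
  define u where "u = length (applied f g T)"
  define c where "c = counts f g u"
  have stc: "stuck f g c" unfolding c_def u_def using st by (rule stuck_at_length_applied)
  have ap: "applied f g T = applied f g u"
    using stuck_stays(2)[of f g u T] stc st by (simp add: c_def u_def[symmetric])
  \<comment> \<open>\<open>D\<close> holds the exhausted students. Each accounts for
    \<open>L\<close> applications, whence \<open>L * card D\<close> is at most
    \<open>T\<close>.\<close>
  define D where "D = {j. j < N \<and> L \<le> c j}"
  define appl where "appl s = {j. j < N \<and> j \<noteq> i\<^sub>0 \<and> 0 < c j \<and> f j ! (c j - 1) = s}" for s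
  define top where "top s = {j\<in>appl s. card {x\<in>appl s. pos (g s) x < pos (g s) j} < q}" for s
  have "L * card D = (\<Sum>j\<in>D. L)" by simp
  also have "\<dots> \<le> (\<Sum>j\<in>D. c j)" by (rule sum_mono) (simp add: D_def)
  also have "\<dots> \<le> (\<Sum>j<N. c j)" by (rule sum_mono2) (auto simp: D_def)
  also have "\<dots> \<le> T" using length_applied[of f g u] ap st by (simp add: c_def)
  finally have LD: "L * card D \<le> T" .
  have app: "f j ! (c j - 1) \<in> set (take (c j) (f j))" if "j < N" "0 < c j" for j
  proof -
    have "c j \<le> length (f j)" using counts_le[of f g u j] len that(1) unfolding c_def by (meson le_trans)
    then show ?thesis using that(2) by (auto simp: in_set_conv_nth intro!: exI[of _ "c j - 1"])
  qed
  \<comment> \<open>A student outside \<open>D\<close> other than \<open>i\<^sub>0\<close> is not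
    pending in the stuck state, so she has entered and is among the top \<open>q\<close> current
    applicants of her latest school.\<close>
  have sub: "{0..<N} \<subseteq> insert i\<^sub>0 (D \<union> (\<Union>s\<in>set (applied f g T). top s))"
  proof
    fix j assume j: "j \<in> {0..<N}"
    show "j \<in> insert i\<^sub>0 (D \<union> (\<Union>s\<in>set (applied f g T). top s))"
    proof (cases "j = i\<^sub>0 \<or> j \<in> D")
      case False
      then have jj: "j < N" "j \<noteq> i\<^sub>0" "c j < L" using j by (auto simp: D_def)
      let ?s = "f j ! (c j - 1)"
      have np: "\<not> pending f g c j" using stc by (simp add: stuck_def)
      have cj: "0 < c j" using np jj by (auto simp: pending_def)
      have "{x\<in>appl ?s. pos (g ?s) x < pos (g ?s) j} = {x. x < N \<and> x \<noteq> i\<^sub>0 \<and> 0 < c x \<and>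
          f x ! (c x - 1) = ?s \<and> pos (g ?s) x < pos (g ?s) j}"
        by (auto simp: appl_def)
      then have "j \<in> top ?s" using np jj cj by (simp add: pending_def top_def appl_def)
      moreover have "?s \<in> set (applied f g T)"
        unfolding ap in_set_applied_iff[OF len dist] using app[OF jj(1) cj] jj(1) by (auto simp: c_def)
      ultimately show ?thesis by auto
    qed auto
  qed
  have fat: "finite (appl s)" for s by (simp add: appl_def)
  have ct: "card (top s) \<le> q" if s: "s \<in> set (applied f g T)" for s
  proof -
    obtain j where "j < N" "s \<in> set (f j)"
      using s unfolding in_set_applied_iff[OF len dist] by (auto dest: in_set_takeD)
    then have "inj_on (pos (g s)) {0..<N}" using inj by blast
    then have "inj_on (pos (g s)) (appl s)" by (rule inj_on_subset) (auto simp: appl_def)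
    then have "card (top s) = min q (card (appl s))" unfolding top_def by (intro card_rank_less fat)
    then show ?thesis by simp
  qed
  have "N \<le> card (insert i\<^sub>0 (D \<union> (\<Union>s\<in>set (applied f g T). top s)))"
    using card_mono[OF _ sub] by (simp add: D_def top_def fat)
  also have "\<dots> \<le> Suc (card (D \<union> (\<Union>s\<in>set (applied f g T). top s)))" by (rule card_insert_le_m1) auto
  also have "\<dots> \<le> Suc (card D + card (\<Union>s\<in>set (applied f g T). top s))" using card_Un_le by simp
  also have "\<dots> \<le> Suc (card D + (\<Sum>s\<in>set (applied f g T). card (top s)))"
    using card_UN_le[of "set (applied f g T)" top] by simp
  also have "\<dots> \<le> Suc (card D + (\<Sum>s\<in>set (applied f g T). q))"
    using sum_mono[OF ct] by simp
  finally have "N \<le> 1 + card D + q * card (set (applied f g T))" by (simp add: mult.commute)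
  \<comment> \<open>Multiplying by \<open>L\<close> avoids dividing \<open>T\<close> by
    \<open>L\<close> in the bound for \<open>card D\<close>.\<close>
  then have "L * N \<le> L * (1 + card D + q * card (set (applied f g T)))" by (rule mult_le_mono2)
  also have "\<dots> = L + L * card D + L * q * card (set (applied f g T))" by (simp add: algebra_simps)
  finally show ?thesis using LD by linarith
qed

text \<open>The run never reads the list of \<open>i\<^sub>0\<close>. Hence her choices stay
  uniformly random given the run.\<close>

lemma counts_upd_excluded: "counts (f(i\<^sub>0 := x)) g t = counts f g t"
proof (induction t)
  case (Suc t)
  have p: "pending (f(i\<^sub>0 := x)) g (counts f g t) i = pending f g (counts f g t) i" for i
    by (rule pending_cong) (auto simp: counts_outside)
  have "stuck (f(i\<^sub>0 := x)) g (counts f g t) = stuck f g (counts f g t)"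
    "mover (f(i\<^sub>0 := x)) g (counts f g t) = mover f g (counts f g t)"
    using p by (simp_all add: stuck_def mover_def)
  then show ?case using Suc by (simp only: counts.simps Let_def)
qed simp

lemma proposers_upd_excluded: "proposers (f(i\<^sub>0 := x)) g t s = proposers f g t s"
  by (auto simp: proposers_def counts_upd_excluded counts_outside)

text \<open>The run consults the priorities of \<open>s\<close> only to compare students who have
  applied there, and all of these lie in \<open>J\<close>. This supplies the locality hypothesis of
  \<open>card_permutations_rank_among_adaptive_le\<close>.\<close>

lemma proposers_upd_priority:
  assumes len: "\<forall>j<N. L \<le> length (f j)"
    and J: "J = proposers f (g(s := \<pi>)) T s"
    and eq: "filter (\<lambda>x. x \<in> J) \<pi>' = filter (\<lambda>x. x \<in> J) \<pi>"
    and set: "{0..<N} \<subseteq> set \<pi>" "{0..<N} \<subseteq> set \<pi>'"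
  shows "proposers f (g(s := \<pi>')) T s = J"
proof -
  have ord: "pos \<pi>' x < pos \<pi>' y \<longleftrightarrow> pos \<pi> x < pos \<pi> y" if "x \<in> J" "y \<in> J" for x y
  proof -
    have "x \<in> {0..<N}" "y \<in> {0..<N}" using that J by (auto simp: proposers_def)
    then have "x \<in> set \<pi>" "y \<in> set \<pi>" "x \<in> set \<pi>'" "y \<in> set \<pi>'" using set by auto
    then show ?thesis using that pos_less_filter[of x \<pi>' y "\<lambda>x. x \<in> J"]
        pos_less_filter[of x \<pi> y "\<lambda>x. x \<in> J"] eq by simp
  qed
  let ?g = "g(s := \<pi>)" and ?g' = "g(s := \<pi>')"
  have "counts f ?g' t = counts f ?g t" if "t \<le> T" for t
    using that
  proof (induction t)
    case (Suc t)
    let ?c = "counts f ?g t"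
    have inJ: "j \<in> J" if "j < N" "0 < ?c j" "f j ! (?c j - 1) = s" for j
    proof -
      have "?c j \<le> length (f j)" using counts_le[of f ?g t j] len that(1) by (meson le_trans)
      then have "s \<in> set (take (?c j) (f j))"
        using that(2,3) by (auto simp: in_set_conv_nth intro!: exI[of _ "?c j - 1"])
      then have "j \<in> proposers f ?g t s" using that(1) by (simp add: proposers_def)
      then show ?thesis using proposers_mono[of t T f ?g s] Suc.prems J by auto
    qed
    have p: "pending f ?g' ?c i = pending f ?g ?c i" for i
    proof (cases "i < N \<and> 0 < ?c i \<and> f i ! (?c i - 1) = s")
      case True
      then have "{j. j < N \<and> j \<noteq> i\<^sub>0 \<and> 0 < ?c j \<and> f j ! (?c j - 1) = s \<and> pos \<pi>' j < pos \<pi>' i}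
         = {j. j < N \<and> j \<noteq> i\<^sub>0 \<and> 0 < ?c j \<and> f j ! (?c j - 1) = s \<and> pos \<pi> j < pos \<pi> i}"
        using ord inJ by blast
      then show ?thesis using True unfolding pending_def by simp
    qed (auto simp: pending_def)
    then have "stuck f ?g' ?c = stuck f ?g ?c" "mover f ?g' ?c = mover f ?g ?c"
      by (simp_all add: stuck_def mover_def)
    moreover have "counts f ?g' t = ?c" by (rule Suc.IH) (use Suc.prems in simp)
    ultimately show ?case by (simp only: counts.simps Let_def)
  qed simp
  then show ?thesis using J by (simp add: proposers_def)
qed

end

section \<open>Comparison of the sequential run with deferred acceptance\<close>

text \<open>Had \<open>j\<close> been rejected by \<open>s\<close>, at least \<open>q\<close>
  applicants would beat \<open>j\<close> there. They would also beat \<open>i\<close>, as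
  \<open>j\<close> does, contradicting \<open>few\<close>.\<close>

lemma beaten_by_ever_applied:
  assumes P: "P \<in> instances n q" and k: "justified n q P k" and s: "s < n"
    and j: "j < n * q" "m \<le> k j" "k j < n" "fst P j ! m = s" "pos (snd P s) j < pos (snd P s) i"
    and few: "card (beating n q P k s i) < q"
  shows "j \<in> beating n q P k s i"
proof (cases "m = k j")
  case True
  then show ?thesis using j by (simp add: applicants_def)
next
  case False
  then have "q \<le> card (beating n q P k s j)" using k j by (auto simp: justified_def)
  also have "\<dots> \<le> card (beating n q P k s i)" by (rule card_mono) (use j in auto)
  finally show ?thesis using few by simp
qed

context sequential_da
begin

text \<open>Omitting \<open>i\<^sub>0\<close> and capping applications reaches no new school. The
  first student to pass her final school \<open>s\<close> would be beaten there by \<open>q\<close>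
  earlier applicants of the run; by induction each of them also reaches \<open>s\<close> in deferred
  acceptance, so they would beat her in the final state.\<close>

lemma counts_le_da_state:
  assumes P: "P \<in> instances n q" and N: "N = n * q" and "j < N"
  shows "counts (fst P) (snd P) t j \<le> Suc (da_state n q P j)"
  using assms(3)
proof (induction t arbitrary: j)
  case (Suc t)
  let ?c = "counts (fst P) (snd P) t" and ?k = "da_state n q P"
  let ?f = "fst P" and ?g = "snd P"
  show ?case
  proof (cases "stuck ?f ?g ?c \<or> j \<noteq> mover ?f ?g ?c")
    case True
    then show ?thesis using Suc by (auto simp: Let_def)
  next
    case False
    then have pe: "pending ?f ?g ?c j" using pending_mover by auto
    have cS: "counts ?f ?g (Suc t) j = Suc (?c j)" using False by (simp add: Let_def)
    have "?c j \<le> ?k j"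
    proof (rule ccontr)
      assume "\<not> ?c j \<le> ?k j"
      then have cj: "?c j = Suc (?k j)" using Suc.IH[OF Suc.prems] by simp
      define s where "s = ?f j ! ?k j"
      have jn: "j < n * q" using Suc.prems N by simp
      have kn: "?k j < n" by (rule da_state_less[OF P jn])
      have sn: "s < n" unfolding s_def by (rule instances_nth_less[OF P jn kn])
      have few: "card (beating n q P ?k s j) < q"
        using da_state_not_rejected[OF P, of j] jn kn by (simp add: rejected_def Let_def s_def)
      have "q \<le> card {x. x < N \<and> x \<noteq> i\<^sub>0 \<and> 0 < ?c x \<and> ?f x ! (?c x - 1) = s \<and> pos (?g s) x < pos (?g s) j}"
        using pe cj by (simp add: pending_def s_def)
      also have "\<dots> \<le> card (beating n q P ?k s j)"
      proof (rule card_mono)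
        show "{x. x < N \<and> x \<noteq> i\<^sub>0 \<and> 0 < ?c x \<and> ?f x ! (?c x - 1) = s \<and> pos (?g s) x < pos (?g s) j}
          \<subseteq> beating n q P ?k s j"
        proof
          fix x assume "x \<in> {x. x < N \<and> x \<noteq> i\<^sub>0 \<and> 0 < ?c x \<and> ?f x ! (?c x - 1) = s \<and> pos (?g s) x < pos (?g s) j}"
          then have x: "x < N" "?f x ! (?c x - 1) = s" "pos (?g s) x < pos (?g s) j" by auto
          have "?c x - 1 \<le> ?k x" using Suc.IH[OF x(1)] by simp
          then show "x \<in> beating n q P ?k s j"
            using x N da_state_less[OF P]
            by (intro beaten_by_ever_applied[OF P justified_da_state[OF P] sn _ _ _ _ _ few]) auto
        qed
      qed simp
      finally show False using few by simp
    qed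
    then show ?thesis using cS by simp
  qed
qed simp

text \<open>Everyone who applied to \<open>s\<close> in the run also applies to \<open>s\<close> in
  deferred acceptance. Those ahead of \<open>i\<^sub>0\<close> are then final applicants ahead of
  her, and she is not rejected.\<close>

lemma card_better_proposers_less:
  assumes P: "P \<in> instances n q" and N: "N = n * q" and i: "i\<^sub>0 < N"
    and s: "s = fst P i\<^sub>0 ! da_state n q P i\<^sub>0"
  shows "card {j \<in> proposers (fst P) (snd P) t s. pos (snd P s) j < pos (snd P s) i\<^sub>0} < q"
proof -
  let ?k = "da_state n q P"
  have i': "i\<^sub>0 < n * q" using i N by simp
  have kn: "?k i\<^sub>0 < n" by (rule da_state_less[OF P i'])
  have sn: "s < n" unfolding s by (rule instances_nth_less[OF P i' kn])
  have few: "card (beating n q P ?k s i\<^sub>0) < q"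
    using da_state_not_rejected[OF P, of i\<^sub>0] i' kn by (simp add: rejected_def Let_def s)
  have "{j \<in> proposers (fst P) (snd P) t s. pos (snd P s) j < pos (snd P s) i\<^sub>0}
      \<subseteq> beating n q P ?k s i\<^sub>0"
  proof
    fix j assume "j \<in> {j \<in> proposers (fst P) (snd P) t s. pos (snd P s) j < pos (snd P s) i\<^sub>0}"
    then have j: "j < N" "s \<in> set (take (counts (fst P) (snd P) t j) (fst P j))"
      "pos (snd P s) j < pos (snd P s) i\<^sub>0" by (auto simp: proposers_def)
    then obtain m where m: "m < counts (fst P) (snd P) t j" "fst P j ! m = s"
      by (auto simp: in_set_conv_nth)
    have "m \<le> ?k j" using m(1) counts_le_da_state[OF P N j(1), of t] by simp
    then show "j \<in> beating n q P ?k s i\<^sub>0"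
      using j m N da_state_less[OF P]
      by (intro beaten_by_ever_applied[OF P justified_da_state[OF P] sn _ _ _ _ _ few]) auto
  qed
  then have "card {j \<in> proposers (fst P) (snd P) t s. pos (snd P s) j < pos (snd P s) i\<^sub>0}
     \<le> card (beating n q P ?k s i\<^sub>0)"
    by (intro card_mono) auto
  then show ?thesis using few by simp
qed

end

subsection \<open>Random words\<close>

abbreviation words :: "nat \<Rightarrow> nat \<Rightarrow> nat list set" where
  "words n T \<equiv> {v. set v \<subseteq> {0..<n} \<and> length v = T}"

lemma finite_words: "finite (words n T)"
  by (rule finite_lists_length_eq) simp

lemma card_words: "card (words n T) = n ^ T"
  by (simp add: card_lists_length_eq)

lemma sum_prod_list_words:
  fixes w :: "nat \<Rightarrow> real"
  shows "(\<Sum>v\<in>words n T. prod_list (map w v)) = (\<Sum>s\<in>{0..<n}. w s) ^ T"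
proof (induction T)
  case 0
  have "words n 0 = {[]}" by auto
  then show ?case by simp
next
  case (Suc T)
  have "(\<Sum>v\<in>words n (Suc T). prod_list (map w v))
      = (\<Sum>(v, s)\<in>words n T \<times> {0..<n}. prod_list (map w (s # v)))"
    unfolding lists_length_Suc_eq
    by (subst sum.reindex) (auto simp: inj_on_def case_prod_beta intro!: sum.cong)
  also have "\<dots> = (\<Sum>v\<in>words n T. \<Sum>s\<in>{0..<n}. w s * prod_list (map w v))"
    by (simp add: sum.cartesian_product)
  also have "\<dots> = (\<Sum>v\<in>words n T. prod_list (map w v)) * (\<Sum>s\<in>{0..<n}. w s)"
    by (simp add: sum_distrib_left sum_distrib_right mult.commute)
  finally show ?case using Suc by (simp add: mult.commute)
qed

lemma prod_list_half_filter:
  "prod_list (map (\<lambda>s. if s \<in> S then 1/2 else 1) v) = (1/2 :: real) ^ length (filter (\<lambda>s. s \<in> S) v)"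
  by (induction v) auto

lemma length_filter_eq_sum_count:
  assumes "finite S"
  shows "length (filter (\<lambda>s. s \<in> S) v) = (\<Sum>s\<in>S. count_list v s)"
proof (induction v)
  case (Cons a v)
  have "(\<Sum>s\<in>S. count_list (a # v) s) = (\<Sum>s\<in>S. (if s = a then 1 else 0) + count_list v s)"
    by (rule sum.cong) auto
  also have "\<dots> = (if a \<in> S then 1 else 0) + (\<Sum>s\<in>S. count_list v s)"
    using assms by (simp add: sum.distrib)
  finally show ?case using Cons by simp
qed simp

text \<open>Exponential Markov inequality with weight \<open>1/2\<close> per hit.\<close>

lemma card_words_few_hits_on_le:
  assumes "S \<subseteq> {0..<n}"
  shows "real (card {v \<in> words n T. \<forall>s\<in>S. count_list v s < M})
    \<le> 2 ^ (M * n) * (real n - real (card S) / 2) ^ T"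
proof -
  let ?X = "{v \<in> words n T. \<forall>s\<in>S. count_list v s < M}"
  let ?w = "\<lambda>s. if s \<in> S then 1/2 else 1 :: real"
  have fS: "finite S" using assms finite_subset by auto
  have cS: "card S \<le> n" using card_mono[OF _ assms] by simp
  \<comment> \<open>Fewer than \<open>M\<close> hits on each letter of \<open>S\<close> make at most
    \<open>M * n\<close> hits in total, which bounds the weight of the word from below.\<close>
  have "(1/2) ^ (M * n) \<le> prod_list (map ?w v)" if "v \<in> ?X" for v
  proof -
    have "length (filter (\<lambda>s. s \<in> S) v) \<le> (\<Sum>s\<in>S. M)"
      unfolding length_filter_eq_sum_count[OF fS] using that by (intro sum_mono) (auto intro: less_imp_le)
    also have "\<dots> \<le> M * n" using cS by simp
    finally show ?thesis unfolding prod_list_half_filter by (intro power_decreasing) auto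
  qed
  then have "real (card ?X) * (1/2) ^ (M * n) \<le> (\<Sum>v\<in>?X. prod_list (map ?w v))"
    by (rule sum_bounded_below)
  also have "\<dots> \<le> (\<Sum>v\<in>words n T. prod_list (map ?w v))"
    by (rule sum_mono2) (auto simp: finite_words prod_list_half_filter)
  also have "\<dots> = (\<Sum>s\<in>{0..<n}. ?w s) ^ T" by (rule sum_prod_list_words)
  also have "(\<Sum>s\<in>{0..<n}. ?w s) = (\<Sum>s\<in>{0..<n}. 1 - (if s \<in> S then 1/2 else 0))"
    by (rule sum.cong) auto
  also have "\<dots> = real n - real (card S) / 2"
    using assms by (simp add: sum_subtractf sum.inter_restrict[symmetric] inf_absorb2)
  finally show ?thesis by (simp add: power_divide field_simps)
qed

text \<open>Union bound over at most \<open>2 ^ n\<close> sets of letters. The factors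
  \<open>2 ^ n\<close> and \<open>2 ^ (M * n)\<close> are of fixed base to the power
  \<open>n\<close>, so they are beaten when \<open>T\<close> is a large multiple of
  \<open>n\<close>.\<close>

lemma card_words_many_rarely_hit_le:
  fixes \<eta> :: real
  assumes "\<eta> \<le> 1"
  shows "real (card {v \<in> words n T. \<eta> * n \<le> card {s\<in>{0..<n}. count_list v s < M}})
    \<le> 2 ^ n * (2 ^ (M * n) * (real n * (1 - \<eta> / 2)) ^ T)"
proof -
  let ?\<S> = "{S. S \<subseteq> {0..<n} \<and> \<eta> * n \<le> card S}"
  let ?X = "\<lambda>S. {v \<in> words n T. \<forall>s\<in>S. count_list v s < M}"
  have fin: "finite ?\<S>" by (rule finite_subset[of _ "Pow {0..<n}"]) auto
  have "{v \<in> words n T. \<eta> * n \<le> card {s\<in>{0..<n}. count_list v s < M}} \<subseteq> (\<Union>S\<in>?\<S>. ?X S)"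
  proof
    fix v assume v: "v \<in> {v \<in> words n T. \<eta> * n \<le> card {s\<in>{0..<n}. count_list v s < M}}"
    let ?S = "{s\<in>{0..<n}. count_list v s < M}"
    have "?S \<in> ?\<S>" using v by blast
    moreover have "v \<in> ?X ?S" using v by blast
    ultimately show "v \<in> (\<Union>S\<in>?\<S>. ?X S)" by (rule UN_I)
  qed
  then have "card {v \<in> words n T. \<eta> * n \<le> card {s\<in>{0..<n}. count_list v s < M}} \<le> card (\<Union>S\<in>?\<S>. ?X S)"
    by (intro card_mono finite_UN_I[OF fin] finite_subset[OF _ finite_words[of n T]]) auto
  also have "\<dots> \<le> (\<Sum>S\<in>?\<S>. card (?X S))" by (rule card_UN_le[OF fin])
  finally have "real (card {v \<in> words n T. \<eta> * n \<le> card {s\<in>{0..<n}. count_list v s < M}})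
     \<le> (\<Sum>S\<in>?\<S>. real (card (?X S)))" by (simp only: of_nat_le_iff of_nat_sum[symmetric])
  also have "\<dots> \<le> (\<Sum>S\<in>?\<S>. 2 ^ (M * n) * (real n * (1 - \<eta> / 2)) ^ T)"
  proof (rule sum_mono)
    fix S assume S: "S \<in> ?\<S>"
    have "card S \<le> n" using S card_mono[of "{0..<n}" S] by auto
    then have le: "(real n - real (card S) / 2) ^ T \<le> (real n * (1 - \<eta> / 2)) ^ T"
      using S by (intro power_mono) (auto simp: algebra_simps)
    have "real (card (?X S)) \<le> 2 ^ (M * n) * (real n - real (card S) / 2) ^ T"
      by (rule card_words_few_hits_on_le) (use S in blast)
    then show "real (card (?X S)) \<le> 2 ^ (M * n) * (real n * (1 - \<eta> / 2)) ^ T"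
      by (rule order_trans) (rule mult_left_mono[OF le], simp)
  qed
  also have "\<dots> = real (card ?\<S>) * (2 ^ (M * n) * (real n * (1 - \<eta> / 2)) ^ T)" by simp
  also have "\<dots> \<le> 2 ^ n * (2 ^ (M * n) * (real n * (1 - \<eta> / 2)) ^ T)"
  proof (rule mult_right_mono)
    have "card ?\<S> \<le> card (Pow {0..<n})" by (rule card_mono) auto
    also have "\<dots> = 2 ^ n" by (simp add: card_Pow)
    finally show "real (card ?\<S>) \<le> 2 ^ n" using of_nat_le_iff[where 'a=real] by fastforce
    show "0 \<le> 2 ^ (M * n) * (real n * (1 - \<eta> / 2)) ^ T" using assms by simp
  qed
  finally show ?thesis .
qed

text \<open>Chebyshev's inequality: the events that given letters are missing are pairwise negatively
correlated, so the variance of their number is at most its mean \<open>\<mu>\<close>.\<close>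

lemma card_words_few_missing_le:
  fixes n T :: nat
  defines "\<mu> \<equiv> real n * (1 - 1 / real n) ^ T"
  assumes n: "2 \<le> n"
  shows "real (card {v \<in> words n T. real (n - card (set v)) \<le> \<mu> / 2}) * \<mu> \<le> 4 * real n ^ T"
proof -
  define Z where "Z v = (\<Sum>s\<in>{0..<n}. if s \<in> set v then 0 else 1 :: real)" for v :: "nat list"
  have Zeq: "Z v = real (n - card (set v))" if "v \<in> words n T" for v
  proof -
    have "Z v = real (card ({0..<n} - set v))"
      unfolding Z_def by (subst sum.mono_neutral_cong_right[of _ "{0..<n} - set v" _ "\<lambda>_. 1"]) auto
    then show ?thesis using that by (simp add: card_Diff_subset)
  qed
  \<comment> \<open>Used for singletons to get the mean of \<open>Z\<close> and for sets
    \<open>{s, r}\<close> to get its second moment.\<close>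
  have miss: "(\<Sum>v\<in>words n T. if set v \<inter> S = {} then 1 else 0 :: real) = real ((n - card S) ^ T)"
    if "S \<subseteq> {0..<n}" for S
  proof -
    have "(\<Sum>v\<in>words n T. if set v \<inter> S = {} then 1 else 0 :: real)
        = real (card {v\<in>words n T. set v \<inter> S = {}})"
      by (subst sum.inter_filter[symmetric]) (auto simp: finite_words)
    also have "{v\<in>words n T. set v \<inter> S = {}} = {v. set v \<subseteq> {0..<n} - S \<and> length v = T}" by auto
    also have "card \<dots> = (n - card S) ^ T"
      using that by (subst card_lists_length_eq) (auto simp: card_Diff_subset finite_subset)
    finally show ?thesis .
  qed
  have pw: "real (n - 1) ^ T = real n ^ T * (1 - 1 / n) ^ T"
    using n by (simp add: power_mult_distrib[symmetric] field_simps of_nat_diff)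
  have "(\<Sum>v\<in>words n T. Z v) = (\<Sum>s\<in>{0..<n}. \<Sum>v\<in>words n T. if s \<in> set v then 0 else 1)"
    unfolding Z_def by (rule sum.swap)
  also have "\<dots> = (\<Sum>s\<in>{0..<n}. real ((n - 1) ^ T))"
  proof (rule sum.cong)
    fix s assume "s \<in> {0..<n}"
    then show "(\<Sum>v\<in>words n T. if s \<in> set v then 0 else 1) = real ((n - 1) ^ T)"
      using miss[of "{s}"] by (simp add: if_not_P cong: if_cong) (smt (verit) sum.cong)
  qed simp
  also have "\<dots> = real n ^ T * \<mu>" unfolding of_nat_power pw by (simp add: \<mu>_def)
  finally have EZ: "(\<Sum>v\<in>words n T. Z v) = real n ^ T * \<mu>" .
  have "(\<Sum>v\<in>words n T. (Z v)\<^sup>2) =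
     (\<Sum>v\<in>words n T. \<Sum>s\<in>{0..<n}. \<Sum>r\<in>{0..<n}. if set v \<inter> {s, r} = {} then 1 else 0)"
    unfolding Z_def power2_eq_square sum_product by (intro sum.cong) auto
  also have "\<dots> = (\<Sum>s\<in>{0..<n}. \<Sum>v\<in>words n T. \<Sum>r\<in>{0..<n}. if set v \<inter> {s, r} = {} then 1 else 0)"
    by (rule sum.swap)
  also have "\<dots> = (\<Sum>s\<in>{0..<n}. \<Sum>r\<in>{0..<n}. \<Sum>v\<in>words n T. if set v \<inter> {s, r} = {} then 1 else 0)"
    by (intro sum.cong refl sum.swap)
  also have "\<dots> = (\<Sum>s\<in>{0..<n}. \<Sum>r\<in>{0..<n}. real ((n - card {s, r}) ^ T))"
    by (intro sum.cong refl miss) auto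
  also have "\<dots> \<le> (\<Sum>s\<in>{0..<n}. real n ^ T * (1 - 1 / n) ^ T + \<mu> * (real n ^ T * (1 - 1 / n) ^ T))"
  proof (rule sum_mono)
    fix s assume s: "s \<in> {0..<n}"
    \<comment> \<open>Negative correlation: \<open>n - 2\<close> is at most
      \<open>n * (1 - 1 / n)^2\<close>, which equals \<open>n - 2 + 1 / n\<close>.\<close>
    have two: "real ((n - 2) ^ T) \<le> real n ^ T * (1 - 1 / n) ^ T * (1 - 1 / n) ^ T"
    proof -
      have "real (n - 2) \<le> real n * (1 - 1 / n) * (1 - 1 / n)"
        using n by (simp add: field_simps of_nat_diff)
      then have "real (n - 2) ^ T \<le> (real n * (1 - 1 / n) * (1 - 1 / n)) ^ T" by (intro power_mono) auto
      then show ?thesis by (simp add: power_mult_distrib)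
    qed
    have "(\<Sum>r\<in>{0..<n}. real ((n - card {s, r}) ^ T))
      = real ((n - 1) ^ T) + (\<Sum>r\<in>{0..<n} - {s}. real ((n - card {s, r}) ^ T))"
      using s by (subst sum.remove[of _ s]) auto
    also have "(\<Sum>r\<in>{0..<n} - {s}. real ((n - card {s, r}) ^ T)) = (\<Sum>r\<in>{0..<n} - {s}. real ((n - 2) ^ T))"
      by (rule sum.cong) (auto simp: numeral_2_eq_2)
    also have "\<dots> \<le> real n * real ((n - 2) ^ T)"
      unfolding sum_constant by (rule mult_right_mono) (use s in auto)
    also have "\<dots> \<le> real n * (real n ^ T * (1 - 1 / n) ^ T * (1 - 1 / n) ^ T)"
      using two by (intro mult_left_mono) auto
    also have "\<dots> = \<mu> * (real n ^ T * (1 - 1 / n) ^ T)" by (simp add: \<mu>_def mult_ac)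
    finally show "(\<Sum>r\<in>{0..<n}. real ((n - card {s, r}) ^ T))
        \<le> real n ^ T * (1 - 1 / n) ^ T + \<mu> * (real n ^ T * (1 - 1 / n) ^ T)"
      using pw by simp
  qed
  also have "\<dots> = real n ^ T * (\<mu> + \<mu>\<^sup>2)" by (simp add: \<mu>_def power2_eq_square algebra_simps)
  finally have EZ2: "(\<Sum>v\<in>words n T. (Z v)\<^sup>2) \<le> real n ^ T * (\<mu> + \<mu>\<^sup>2)" .
  have "(\<Sum>v\<in>words n T. (Z v - \<mu>)\<^sup>2) = (\<Sum>v\<in>words n T. (Z v)\<^sup>2 - 2 * \<mu> * Z v + \<mu>\<^sup>2)"
    by (simp add: power2_diff algebra_simps)
  also have "\<dots> = (\<Sum>v\<in>words n T. (Z v)\<^sup>2) - 2 * \<mu> * (\<Sum>v\<in>words n T. Z v) + real n ^ T * \<mu>\<^sup>2"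
    by (simp add: sum.distrib sum_subtractf sum_distrib_left card_words)
  also have "\<dots> \<le> real n ^ T * \<mu>"
    using EZ2 unfolding EZ by (simp add: power2_eq_square algebra_simps)
  finally have var: "(\<Sum>v\<in>words n T. (Z v - \<mu>)\<^sup>2) \<le> real n ^ T * \<mu>" .
  have mu: "0 < \<mu>" using n by (simp add: \<mu>_def)
  let ?X = "{v \<in> words n T. real (n - card (set v)) \<le> \<mu> / 2}"
  have "(\<mu> / 2)\<^sup>2 \<le> (Z v - \<mu>)\<^sup>2" if "v \<in> ?X" for v
  proof -
    have "\<mu> / 2 \<le> \<mu> - Z v" using that Zeq by auto
    then have "(\<mu> / 2)\<^sup>2 \<le> (\<mu> - Z v)\<^sup>2" using mu by (intro power_mono) auto
    then show ?thesis by (simp add: power2_commute)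
  qed
  then have "real (card ?X) * (\<mu> / 2)\<^sup>2 \<le> (\<Sum>v\<in>?X. (Z v - \<mu>)\<^sup>2)"
    by (rule sum_bounded_below)
  also have "\<dots> \<le> (\<Sum>v\<in>words n T. (Z v - \<mu>)\<^sup>2)"
    by (rule sum_mono2) (auto simp: finite_words)
  also note var
  finally have "(real (card ?X) * \<mu>) * \<mu> \<le> (4 * real n ^ T) * \<mu>"
    by (simp add: power2_eq_square field_simps)
  then show ?thesis using mu by simp
qed

subsection \<open>Comparing a run with a random word\<close>

abbreviation profiles :: "nat \<Rightarrow> nat \<Rightarrow> (nat \<Rightarrow> nat list) set" where
  "profiles N n \<equiv> PiE {0..<N} (\<lambda>_. permutations_of_set {0..<n})"

lemma finite_profiles [simp]: "finite (profiles N n)"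
  by (intro finite_PiE) auto

lemma card_profiles: "card (profiles N n) = fact n ^ N"
  by (simp add: card_PiE)

lemma profilesD:
  assumes "f \<in> profiles N n" "j < N"
  shows "distinct (f j)" "set (f j) = {0..<n}" "length (f j) = n"
proof -
  have "f j \<in> permutations_of_set {0..<n}" using assms by auto
  then show "distinct (f j)" "set (f j) = {0..<n}" "length (f j) = n"
    by (auto simp: permutations_of_set_def distinct_card[symmetric])
qed

context sequential_da
begin

text \<open>The record fixes the prefix that each student has used. The prefix bounds multiply over
  the independent lists, and the prefix lengths add up to \<open>length w\<close>.\<close>

lemma card_applied_fibre_le:
  assumes "L \<le> n"
  shows "card {f \<in> profiles N n. applied f g T = w} * (n - L) ^ length w \<le> card (profiles N n)"
proof (cases "{f \<in> profiles N n. applied f g T = w} = {}")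
  case True
  show ?thesis unfolding True by simp
next
  case False
  then obtain f0 where f0: "f0 \<in> profiles N n" "applied f0 g T = w" by auto
  define c where "c = counts f0 g T"
  let ?X = "\<lambda>j. {xs \<in> permutations_of_set {0..<n}. take (c j) xs = take (c j) (f0 j)}"
  have len: "\<forall>j<N. L \<le> length (f j)" if "f \<in> profiles N n" for f
    using profilesD(3)[OF that] assms by simp
  have "{f \<in> profiles N n. applied f g T = w} \<subseteq> PiE {0..<N} ?X"
  proof
    fix f assume f: "f \<in> {f \<in> profiles N n. applied f g T = w}"
    then have "applied f0 g T = applied f g T" using f0 by simp
    then have "\<forall>j<N. take (c j) (f0 j) = take (c j) (f j)"
      using applied_determines_prefixes[of f0 g T f T] len f f0 by (auto simp: c_def)
    then show "f \<in> PiE {0..<N} ?X" using f by (auto simp: PiE_iff)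
  qed
  then have "card {f \<in> profiles N n. applied f g T = w} \<le> card (PiE {0..<N} ?X)"
    by (intro card_mono finite_PiE) auto
  also have "\<dots> = (\<Prod>j\<in>{0..<N}. card (?X j))" by (rule card_PiE) simp
  finally have "card {f \<in> profiles N n. applied f g T = w} * (n - L) ^ length w
      \<le> (\<Prod>j\<in>{0..<N}. card (?X j)) * (n - L) ^ (\<Sum>j<N. c j)"
    using length_applied[of f0 g T] f0(2) by (simp add: c_def)
  also have "\<dots> = (\<Prod>j\<in>{0..<N}. card (?X j) * (n - L) ^ c j)"
    by (simp add: power_sum prod.distrib lessThan_atLeast0)
  also have "\<dots> \<le> (\<Prod>j\<in>{0..<N}. fact n)"
  proof (rule prod_mono, intro conjI)
    fix j
    show "card (?X j) * (n - L) ^ c j \<le> fact n"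
      by (rule card_permutations_with_prefix_le) (use assms counts_le in \<open>auto simp: c_def\<close>)
  qed simp
  also have "\<dots> = card (profiles N n)" by (simp add: card_profiles)
  finally show ?thesis .
qed

text \<open>A final record \<open>w\<close> has probability at most \<open>(n - L) ^ - length w\<close>, and distinct records are
not prefixes of each other, so records can be compared with uniformly random words.\<close>

lemma card_applied_bad_le:
  assumes "L \<le> n"
  shows "card {f \<in> profiles N n. Bad (applied f g T)} * (n - L) ^ T
    \<le> card (profiles N n) * card {v \<in> words n T. \<exists>f \<in> profiles N n. Bad (applied f g T) \<and>
          take (length (applied f g T)) v = applied f g T}"
proof -
  let ?F = "{f \<in> profiles N n. Bad (applied f g T)}"
  define W where "W = (\<lambda>f. applied f g T) ` ?F"
  \<comment> \<open>The words of length \<open>T\<close> extending \<open>w\<close>. There are at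
    least \<open>n ^ (T - length w)\<close> of them, and prefix-freeness makes the sets for
    different records disjoint.\<close>
  define ext where "ext w = {v \<in> words n T. take (length w) v = w}" for w
  have len: "\<forall>j<N. L \<le> length (f j)" if "f \<in> profiles N n" for f
    using profilesD(3)[OF that] assms by simp
  have fW: "finite W" by (simp add: W_def)
  have fext: "finite (ext w)" for w
    by (rule finite_subset[OF _ finite_words[of n T]]) (auto simp: ext_def)
  have wW: "length w \<le> T" "set w \<subseteq> {0..<n}" if w: "w \<in> W" for w
  proof -
    obtain f where f: "f \<in> profiles N n" "w = applied f g T" using w by (auto simp: W_def)
    show "length w \<le> T" unfolding f(2) by (rule length_applied_le)
    have dist: "\<forall>j<N. distinct (f j)" using profilesD(1)[OF f(1)] by simp
    show "set w \<subseteq> {0..<n}"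
      using in_set_applied_iff[OF len[OF f(1)] dist] profilesD(2)[OF f(1)] f(2)
      by (metis in_set_takeD subsetI)
  qed
  have cext: "n ^ (T - length w) \<le> card (ext w)" if "w \<in> W" for w
  proof -
    have "card (words n (T - length w)) \<le> card (ext w)"
    proof (rule card_inj_on_le[of "\<lambda>u. w @ u"])
      show "(\<lambda>u. w @ u) ` words n (T - length w) \<subseteq> ext w" using wW[OF that] by (auto simp: ext_def subset_eq)
    qed (auto simp: inj_on_def fext)
    then show ?thesis by (simp add: card_words)
  qed
  have pf: "w = w'" if w: "w \<in> W" "w' \<in> W" "v \<in> ext w" "v \<in> ext w'" "length w \<le> length w'" for w w' v
  proof -
    obtain f where f: "f \<in> profiles N n" "w = applied f g T" using w by (auto simp: W_def)
    obtain f' where f': "f' \<in> profiles N n" "w' = applied f' g T" using w by (auto simp: W_def)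
    have "take (length w) w' = w" using w by (auto simp: ext_def min_def) (metis min.absorb1 take_take)
    then have "applied f' g T = applied f g T"
      using applied_prefix_free[of f g T f'] len f f' by simp
    then show ?thesis using f f' by simp
  qed
  have disj: "ext w \<inter> ext w' = {}" if "w \<in> W" "w' \<in> W" "w \<noteq> w'" for w w'
  proof (rule ccontr)
    assume "ext w \<inter> ext w' \<noteq> {}"
    then obtain v where v: "v \<in> ext w" "v \<in> ext w'" by blast
    show False
      using pf[OF that(1,2) v] pf[OF that(2,1) v(2,1)] that(3) nat_le_linear[of "length w" "length w'"] by auto
  qed
  have "card ?F = (\<Sum>w\<in>W. card {f\<in>?F. applied f g T = w})"
    unfolding W_def by (rule card_eq_sum_fibres) simp
  then have "card ?F * (n - L) ^ T = (\<Sum>w\<in>W. card {f\<in>?F. applied f g T = w} * (n - L) ^ T)"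
    by (simp only: sum_distrib_right)
  also have "\<dots> \<le> (\<Sum>w\<in>W. card (profiles N n) * card (ext w))"
  proof (rule sum_mono)
    fix w assume w: "w \<in> W"
    have "(n - L) ^ T = (n - L) ^ length w * (n - L) ^ (T - length w)"
      using wW(1)[OF w] by (simp flip: power_add)
    also have "\<dots> \<le> (n - L) ^ length w * card (ext w)"
      using cext[OF w] power_mono[of "n - L" n "T - length w"] by (intro mult_le_mono2) linarith
    finally have "card {f\<in>?F. applied f g T = w} * (n - L) ^ T
        \<le> card {f\<in>?F. applied f g T = w} * ((n - L) ^ length w * card (ext w))" by (rule mult_le_mono2)
    also have "\<dots> \<le> card {f\<in>profiles N n. applied f g T = w} * ((n - L) ^ length w * card (ext w))"
      by (intro mult_le_mono1 card_mono) auto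
    also have "\<dots> \<le> card (profiles N n) * card (ext w)"
      using mult_le_mono1[OF card_applied_fibre_le[OF assms, of g T w], of "card (ext w)"]
      by (simp only: mult.assoc)
    finally show "card {f\<in>?F. applied f g T = w} * (n - L) ^ T \<le> card (profiles N n) * card (ext w)" .
  qed
  also have "\<dots> = card (profiles N n) * (\<Sum>w\<in>W. card (ext w))" by (rule sum_distrib_left[symmetric])
  also have "(\<Sum>w\<in>W. card (ext w)) = card (\<Union>w\<in>W. ext w)"
    by (rule card_UN_disjoint[symmetric]) (use fW fext disj in auto)
  also have "(\<Union>w\<in>W. ext w) = {v \<in> words n T. \<exists>f \<in> profiles N n. Bad (applied f g T) \<and>
          take (length (applied f g T)) v = applied f g T}"
    by (auto simp: W_def ext_def)
  finally show ?thesis .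
qed

text \<open>A word extending a bad record is bad for one of two reasons. If the record is complete,
  the word equals it and hits many letters rarely; if the run stopped early,
  \<open>stuck_covers\<close> shows that the word uses many distinct letters.\<close>

lemma card_few_proposers_le:
  fixes \<eta> :: real
  assumes "L \<le> n" and g: "g \<in> profiles n N"
  shows "card {f \<in> profiles N n. \<eta> * n \<le> card {s\<in>{0..<n}. card (proposers f g T s) < M}} * (n - L) ^ T
    \<le> card (profiles N n) * (card {v \<in> words n T. \<eta> * n \<le> card {s\<in>{0..<n}. count_list v s < M}}
        + card {v \<in> words n T. L * N \<le> L + T + L * q * card (set v)})"
proof -
  define Bad where "Bad w \<longleftrightarrow> \<eta> * n \<le> card {s\<in>{0..<n}. count_list w s < M}" for w
  let ?V = "{v \<in> words n T. \<exists>f \<in> profiles N n. Bad (applied f g T) \<and>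
          take (length (applied f g T)) v = applied f g T}"
  let ?V1 = "{v \<in> words n T. \<eta> * n \<le> card {s\<in>{0..<n}. count_list v s < M}}"
  let ?V2 = "{v \<in> words n T. L * N \<le> L + T + L * q * card (set v)}"
  have ok: "\<forall>j<N. L \<le> length (f j)" "\<forall>j<N. distinct (f j)" if "f \<in> profiles N n" for f
    using profilesD[OF that] assms by simp_all
  have "?V \<subseteq> ?V1 \<union> ?V2"
  proof
    fix v assume "v \<in> ?V"
    then obtain f where f: "f \<in> profiles N n" "Bad (applied f g T)"
      "take (length (applied f g T)) v = applied f g T" and v: "v \<in> words n T" by blast
    show "v \<in> ?V1 \<union> ?V2"
    proof (cases "length (applied f g T) < T")
      case True
      have inj: "\<forall>j<N. \<forall>s\<in>set (f j). inj_on (pos (g s)) {0..<N}"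
      proof (intro allI ballI impI)
        fix j s assume "j < N" "s \<in> set (f j)"
        then have "s < n" using profilesD(2)[OF f(1)] by auto
        then show "inj_on (pos (g s)) {0..<N}" using profilesD[OF g]
          by (auto simp: inj_on_def pos_inject)
      qed
      have "L * N \<le> L + T + L * q * card (set (applied f g T))"
        by (rule stuck_covers[OF ok[OF f(1)] inj True])
      also have "\<dots> \<le> L + T + L * q * card (set v)"
        using f(3) set_take_subset[of "length (applied f g T)" v]
        by (intro add_le_mono order_refl mult_le_mono2 card_mono) auto
      finally show ?thesis using v by blast
    next
      case False
      then have "applied f g T = v" using f(3) v by auto
      then show ?thesis using f(2) v by (auto simp: Bad_def)
    qed
  qed
  then have "card ?V \<le> card (?V1 \<union> ?V2)"
    by (intro card_mono finite_subset[OF _ finite_words[of n T]]) auto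
  also have "\<dots> \<le> card ?V1 + card ?V2" by (rule card_Un_le)
  finally have V: "card ?V \<le> card ?V1 + card ?V2" .
  have "{f \<in> profiles N n. \<eta> * n \<le> card {s\<in>{0..<n}. card (proposers f g T s) < M}}
     = {f \<in> profiles N n. Bad (applied f g T)}"
    unfolding Bad_def using count_applied[OF ok] by auto
  then have "card {f \<in> profiles N n. \<eta> * n \<le> card {s\<in>{0..<n}. card (proposers f g T s) < M}} * (n - L) ^ T
     \<le> card (profiles N n) * card ?V"
    using card_applied_bad_le[OF assms(1), of Bad g T] by simp
  also have "\<dots> \<le> card (profiles N n) * (card ?V1 + card ?V2)" using V by (rule mult_le_mono2)
  finally show ?thesis .
qed

end

text \<open>On this range \<open>x^2\<close> is at most \<open>x / 2\<close>, so
  \<open>ln (1 - x)\<close> is at least \<open>- x - 2 * x^2\<close> and hence at least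
  \<open>- 2 * x\<close>.\<close>

lemma one_minus_power_ge_exp:
  fixes x :: real
  assumes "0 \<le> x" "x \<le> 1/2"
  shows "exp (- 2 * x * real m) \<le> (1 - x) ^ m"
proof -
  have "x * x \<le> x * (1/2)" using assms by (intro mult_left_mono) auto
  then have "- 2 * x \<le> - x - 2 * x\<^sup>2" by (simp add: power2_eq_square)
  also have "\<dots> \<le> ln (1 - x)" using assms by (rule ln_one_minus_pos_lower_bound)
  finally have "exp (- 2 * x) \<le> 1 - x" using assms by (simp add: ln_ge_iff)
  then have "exp (- 2 * x) ^ m \<le> (1 - x) ^ m" by (intro power_mono) auto
  then show ?thesis by (simp add: exp_of_nat_mult[symmetric] mult.commute)
qed

text \<open>With \<open>K * n\<close> steps the comparison with random words costs only the constant
  factor \<open>exp (2 * L * K)\<close>. Hypothesis \<open>K\<close> handles words with many rarely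
  hit letters; \<open>LK\<close> makes an early stop require far fewer missing letters than a random
  word has on average.\<close>

lemma few_proposers_ratio_le:
  fixes \<eta> :: real
  assumes n: "2 \<le> n" "2 * L \<le> n" and L: "0 < L" "0 < q" and N: "N = n * q"
    and g: "g \<in> profiles n N" and \<eta>: "\<eta> \<le> 1"
    and K: "2 ^ (M + 1) * (1 - \<eta> / 2) ^ K \<le> 1 / 2"
    and LK: "1 + real (K * n) / L \<le> real n * exp (- 2 * real K) / 2"
  shows "real (card {f \<in> profiles N n. \<eta> * n \<le> card {s\<in>{0..<n}.
            card (sequential_da.proposers N L q i f g (K * n) s) < M}})
    \<le> exp (2 * L * K) * ((1/2) ^ n + 4 * exp (2 * K) / n) * card (profiles N n)"
proof -
  define T where "T = K * n"
  define \<mu> where "\<mu> = real n * (1 - 1 / real n) ^ T"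
  have n0: "0 < real n" using n by simp
  interpret sequential_da N L q i .
  let ?B = "{f \<in> profiles N n. \<eta> * n \<le> card {s\<in>{0..<n}. card (proposers f g T s) < M}}"
  let ?V1 = "{v \<in> words n T. \<eta> * n \<le> card {s\<in>{0..<n}. count_list v s < M}}"
  let ?V2 = "{v \<in> words n T. L * N \<le> L + T + L * q * card (set v)}"
  have "exp (- 2 * (1 / real n) * T) \<le> (1 - 1 / real n) ^ T"
    by (rule one_minus_power_ge_exp) (use n in auto)
  then have "exp (- 2 * real K) \<le> (1 - 1 / real n) ^ T" using n0 by (simp add: T_def)
  then have mu: "real n * exp (- 2 * real K) \<le> \<mu>" unfolding \<mu>_def by (intro mult_left_mono) auto
  have V1: "real (card ?V1) \<le> (1/2) ^ n * real n ^ T"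
  proof -
    have "real (card ?V1) \<le> 2 ^ n * (2 ^ (M * n) * (real n * (1 - \<eta> / 2)) ^ T)"
      by (rule card_words_many_rarely_hit_le[OF \<eta>])
    also have "\<dots> = (2 ^ (M + 1) * (1 - \<eta> / 2) ^ K) ^ n * real n ^ T"
      by (simp add: power_mult_distrib power_mult[symmetric] T_def power_add mult_ac)
    also have "\<dots> \<le> (1/2) ^ n * real n ^ T"
      using K \<eta> by (intro mult_right_mono power_mono) auto
    finally show ?thesis .
  qed
  have V2: "real (card ?V2) \<le> 4 * exp (2 * K) / n * real n ^ T"
  proof -
    have "?V2 \<subseteq> {v \<in> words n T. real (n - card (set v)) \<le> \<mu> / 2}"
    proof
      fix v assume v: "v \<in> ?V2"
      have "card (set v) \<le> n" using v card_mono[of "{0..<n}" "set v"] by auto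
      \<comment> \<open>Total capacity equals the number of students, so the covering inequality
        bounds the number of missing letters by \<open>1 + T / L\<close>.\<close>
      have "L * q * n \<le> L + T + L * q * card (set v)" using v N by (simp add: mult_ac)
      then have "L * q * (n - card (set v)) \<le> L + T"
        using \<open>card (set v) \<le> n\<close> by (simp add: diff_mult_distrib2)
      moreover have "L * (n - card (set v)) \<le> L * q * (n - card (set v))" using L(2) by simp
      ultimately have "L * (n - card (set v)) \<le> L + T" by linarith
      then have "real L * real (n - card (set v)) \<le> real L + real T"
        by (metis of_nat_add of_nat_le_iff of_nat_mult)
      then have "real (n - card (set v)) \<le> 1 + real T / L" using L by (simp add: field_simps)
      also have "\<dots> \<le> \<mu> / 2" using LK mu unfolding T_def by linarith
      finally show "v \<in> {v \<in> words n T. real (n - card (set v)) \<le> \<mu> / 2}" using v by blast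
    qed
    then have "card ?V2 \<le> card {v \<in> words n T. real (n - card (set v)) \<le> \<mu> / 2}"
      by (intro card_mono finite_subset[OF _ finite_words[of n T]]) auto
    then have "real (card ?V2) * (real n * exp (- 2 * real K))
       \<le> real (card {v \<in> words n T. real (n - card (set v)) \<le> \<mu> / 2}) * \<mu>"
      using mu by (intro mult_mono) auto
    also have "\<dots> \<le> 4 * real n ^ T" unfolding \<mu>_def by (rule card_words_few_missing_le[OF n(1)])
    finally show ?thesis using n0 by (simp add: exp_minus field_simps)
  qed
  have "real (card ?B) * real (n - L) ^ T \<le> real (card (profiles N n)) * (real (card ?V1) + real (card ?V2))"
  proof -
    have "L \<le> n" using n by simp
    then have "card ?B * (n - L) ^ T \<le> card (profiles N n) * (card ?V1 + card ?V2)"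
      using g by (rule card_few_proposers_le)
    then have "real (card ?B * (n - L) ^ T) \<le> real (card (profiles N n) * (card ?V1 + card ?V2))"
      by (simp only: of_nat_le_iff)
    then show ?thesis by (simp only: of_nat_mult of_nat_add of_nat_power)
  qed
  also have "\<dots> \<le> real (card (profiles N n)) * ((1/2) ^ n * real n ^ T + 4 * exp (2 * K) / n * real n ^ T)"
    using V1 V2 by (intro mult_left_mono add_mono) auto
  finally have le: "real (card ?B) * real (n - L) ^ T
     \<le> real (card (profiles N n)) * ((1/2) ^ n + 4 * exp (2 * K) / n) * real n ^ T"
    by (simp add: algebra_simps)
  \<comment> \<open>The cost of replacing \<open>(n - L) ^ T\<close> by \<open>n ^ T\<close>; it
    does not grow with \<open>n\<close> because \<open>T = K * n\<close>.\<close>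
  have "exp (- 2 * (real L / n) * T) \<le> (1 - real L / n) ^ T"
    by (rule one_minus_power_ge_exp) (use n in \<open>auto simp: field_simps\<close>)
  then have "exp (- (2 * L * K)) * real n ^ T \<le> (1 - real L / n) ^ T * real n ^ T"
    using n0 by (intro mult_right_mono) (auto simp: T_def field_simps)
  also have "\<dots> = real (n - L) ^ T"
    using n by (simp add: power_mult_distrib[symmetric] field_simps of_nat_diff)
  finally have "real (card ?B) * (exp (- (2 * L * K)) * real n ^ T) \<le> real (card ?B) * real (n - L) ^ T"
    by (intro mult_left_mono) auto
  then have "real (card ?B) * exp (- (2 * L * K)) * real n ^ T
     \<le> real (card (profiles N n)) * ((1/2) ^ n + 4 * exp (2 * K) / n) * real n ^ T"
    using le by (simp add: mult.assoc)
  then have "real (card ?B) * exp (- (2 * L * K)) \<le> real (card (profiles N n)) * ((1/2) ^ n + 4 * exp (2 * K) / n)"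
    using n0 by (simp only: mult_le_cancel_right_pos zero_less_power)
  then show ?thesis unfolding T_def by (simp add: exp_minus field_simps)
qed

subsection \<open>Top choices and prefixes\<close>

lemma card_Collect_eq_sum:
  "finite A \<Longrightarrow> card {x\<in>A. Q x} = (\<Sum>x\<in>A. of_bool (Q x))"
  by (simp add: sum.inter_filter[symmetric] of_bool_def)

lemma card_filter_Times:
  assumes "finite A" "finite B"
  shows "card {(x, y)\<in>A \<times> B. Q x y} = (\<Sum>x\<in>A. card {y\<in>B. Q x y})"
proof -
  have "{(x, y)\<in>A \<times> B. Q x y} = (SIGMA x:A. {y\<in>B. Q x y})" by auto
  then show ?thesis using assms by simp
qed

lemma card_filter_Times':
  assumes "finite A" "finite B"
  shows "card {(x, y)\<in>A \<times> B. Q x y} = (\<Sum>y\<in>B. card {x\<in>A. Q x y})"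
proof -
  have "{(x, y)\<in>A \<times> B. Q x y} = prod.swap ` {(y, x)\<in>B \<times> A. Q x y}" by auto
  then have "card {(x, y)\<in>A \<times> B. Q x y} = card {(y, x)\<in>B \<times> A. Q x y}"
    by (simp add: card_image)
  then show ?thesis using card_filter_Times[OF assms(2,1), of "\<lambda>y x. Q x y"] by simp
qed

context sequential_da
begin

text \<open>All data except the priority list of \<open>s\<close> are frozen. Redrawing that list
  gives the adaptive rank bound, which is then averaged by resampling.\<close>

lemma card_high_rank_le:
  assumes f: "f \<in> profiles N n" and "i\<^sub>0 < N" "L \<le> n" "s < n"
  shows "Suc M * card {g \<in> profiles n N. M \<le> card (proposers f g T s) \<and>
      card {j \<in> proposers f g T s. pos (g s) j < pos (g s) i\<^sub>0} < q} \<le> q * card (profiles n N)"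
proof -
  let ?Q = "\<lambda>g. M \<le> card (proposers f g T s) \<and> card {j \<in> proposers f g T s. pos (g s) j < pos (g s) i\<^sub>0} < q"
  let ?P = "permutations_of_set {0..<N}"
  have inner: "Suc M * (\<Sum>\<pi>\<in>?P. of_bool (?Q (g(s := \<pi>)))) \<le> q * fact N" for g
  proof -
    let ?J = "\<lambda>\<pi>. proposers f (g(s := \<pi>)) T s"
    have "Suc M * card {\<pi> \<in> ?P. M \<le> card (?J \<pi>) \<and> card {j\<in>?J \<pi>. pos \<pi> j < pos \<pi> i\<^sub>0} < q} \<le> q * card ?P"
    proof (rule card_permutations_rank_among_adaptive_le)
      show "i\<^sub>0 \<in> {0..<N}" using assms by simp
      fix \<pi> assume \<pi>: "\<pi> \<in> ?P"
      show "?J \<pi> \<subseteq> {0..<N} - {i\<^sub>0}" by (rule proposers_subset)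
      fix \<pi>' assume \<pi>': "\<pi>' \<in> ?P" "filter (\<lambda>x. x \<in> ?J \<pi>) \<pi>' = filter (\<lambda>x. x \<in> ?J \<pi>) \<pi>"
      show "?J \<pi>' = ?J \<pi>"
      proof (rule proposers_upd_priority[OF _ refl \<pi>'(2)])
        show "\<forall>j<N. L \<le> length (f j)" using profilesD(3)[OF f] assms(3) by simp
        show "{0..<N} \<subseteq> set \<pi>" "{0..<N} \<subseteq> set \<pi>'" using \<pi> \<pi>'(1) by (simp_all add: permutations_of_setD)
      qed
    qed simp
    then show ?thesis by (simp add: card_Collect_eq_sum del: mult_Suc)
  qed
  have "fact N * (Suc M * card {g \<in> profiles n N. ?Q g})
      = Suc M * (card ?P * (\<Sum>g\<in>profiles n N. of_bool (?Q g)))"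
    by (simp only: card_Collect_eq_sum[OF finite_profiles] card_permutations_of_set finite_atLeastLessThan
        card_atLeastLessThan diff_zero mult.left_commute)
  also have "\<dots> = Suc M * (\<Sum>g\<in>profiles n N. \<Sum>\<pi>\<in>?P. of_bool (?Q (g(s := \<pi>))))"
    by (subst sum_resample_coordinate[where i=s]) (use assms in auto)
  also have "\<dots> = (\<Sum>g\<in>profiles n N. Suc M * (\<Sum>\<pi>\<in>?P. of_bool (?Q (g(s := \<pi>)))))"
    by (rule sum_distrib_left)
  also have "\<dots> \<le> (\<Sum>g\<in>profiles n N. q * fact N)" by (rule sum_mono) (rule inner)
  also have "\<dots> = fact N * (q * card (profiles n N))" by simp
  finally show ?thesis by (simp only: mult_le_cancel1 fact_gt_zero)
qed

text \<open>Redrawing the list of \<open>i\<^sub>0\<close> does not affect the run, so her choice at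
  index \<open>m\<close> is a uniformly random school independent of the set of schools with few
  proposers.\<close>

lemma card_choice_few_proposers:
  assumes "i\<^sub>0 < N" "m < n"
  shows "n * card {f \<in> profiles N n. card (proposers f g T (f i\<^sub>0 ! m)) < M}
    = (\<Sum>f\<in>profiles N n. card {s\<in>{0..<n}. card (proposers f g T s) < M})"
proof -
  let ?P = "permutations_of_set {0..<n}"
  let ?B = "\<lambda>f. {s\<in>{0..<n}. card (proposers f g T s) < M}"
  let ?\<phi> = "\<lambda>f. of_bool (card (proposers f g T (f i\<^sub>0 ! m)) < M) :: nat"
  have inner: "n * (\<Sum>x\<in>?P. ?\<phi> (f(i\<^sub>0 := x))) = card (?B f) * fact n" for f
  proof -
    have "(\<Sum>x\<in>?P. ?\<phi> (f(i\<^sub>0 := x))) = (\<Sum>x\<in>?P. of_bool (x ! m \<in> ?B f))"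
    proof (rule sum.cong)
      fix x assume x: "x \<in> ?P"
      have "length x = n" using length_finite_permutations_of_set[OF x] by simp
      then have "x ! m \<in> {0..<n}" using nth_mem[of m x] assms(2) permutations_of_setD(1)[OF x] by simp
      then show "?\<phi> (f(i\<^sub>0 := x)) = of_bool (x ! m \<in> ?B f)"
        by (simp add: proposers_upd_excluded del: fun_upd_apply) (simp add: proposers_upd_excluded)
    qed simp
    also have "\<dots> = card {x\<in>?P. x ! m \<in> ?B f}" by (rule card_Collect_eq_sum[symmetric]) simp
    finally have eq: "(\<Sum>x\<in>?P. ?\<phi> (f(i\<^sub>0 := x))) = card {x\<in>?P. x ! m \<in> ?B f}" .
    have "card {0..<n} * card {x\<in>?P. x ! m \<in> ?B f} = card (?B f) * fact (card {0..<n})"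
      by (rule card_permutations_nth) (use assms(2) in auto)
    then show ?thesis unfolding eq card_atLeastLessThan diff_zero .
  qed
  have "fact n * (n * card {f \<in> profiles N n. card (proposers f g T (f i\<^sub>0 ! m)) < M})
      = n * (card ?P * (\<Sum>f\<in>profiles N n. ?\<phi> f))"
    by (simp only: card_Collect_eq_sum[OF finite_profiles] card_permutations_of_set finite_atLeastLessThan
        card_atLeastLessThan diff_zero mult.left_commute)
  also have "\<dots> = n * (\<Sum>f\<in>profiles N n. \<Sum>x\<in>?P. ?\<phi> (f(i\<^sub>0 := x)))"
    by (subst sum_resample_coordinate[where i=i\<^sub>0]) (use assms in auto)
  also have "\<dots> = (\<Sum>f\<in>profiles N n. n * (\<Sum>x\<in>?P. ?\<phi> (f(i\<^sub>0 := x))))" by (rule sum_distrib_left)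
  also have "\<dots> = (\<Sum>f\<in>profiles N n. card (?B f) * fact n)" by (rule sum.cong) (use inner in auto)
  also have "\<dots> = fact n * (\<Sum>f\<in>profiles N n. card (?B f))"
    by (simp add: sum_distrib_left mult.commute)
  finally show ?thesis by simp
qed

text \<open>The number of schools with few proposers is below \<open>\<eta> * n\<close>, except on
  an event of probability at most \<open>b\<close>, where it is at most \<open>n\<close>.\<close>

lemma card_choice_few_proposers_le:
  fixes \<eta> b :: real
  assumes "i\<^sub>0 < N" "m < n" "0 \<le> \<eta>"
    and b: "real (card {f \<in> profiles N n. \<eta> * n \<le> card {s\<in>{0..<n}. card (proposers f g T s) < M}})
      \<le> b * card (profiles N n)"
  shows "real (card {f \<in> profiles N n. card (proposers f g T (f i\<^sub>0 ! m)) < M}) \<le> (\<eta> + b) * card (profiles N n)"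
proof -
  let ?B = "\<lambda>f. {s\<in>{0..<n}. card (proposers f g T s) < M}"
  have "real n * real (card {f \<in> profiles N n. card (proposers f g T (f i\<^sub>0 ! m)) < M})
      = (\<Sum>f\<in>profiles N n. real (card (?B f)))"
    using arg_cong[OF card_choice_few_proposers[OF assms(1,2), of g T M], of real]
    by (simp only: of_nat_mult of_nat_sum)
  also have "\<dots> \<le> (\<Sum>f\<in>profiles N n. \<eta> * n + real n * of_bool (\<eta> * n \<le> card (?B f)))"
  proof (rule sum_mono)
    fix f
    have "card (?B f) \<le> card {0..<n}" by (rule card_mono) auto
    moreover have "0 \<le> \<eta> * n" using assms(3) by simp
    ultimately show "real (card (?B f)) \<le> \<eta> * n + real n * of_bool (\<eta> * n \<le> card (?B f))" by simp
  qed
  also have "\<dots> = card (profiles N n) * (\<eta> * n) + real n * real (card {f\<in>profiles N n. \<eta> * n \<le> card (?B f)})"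
    by (simp add: sum.distrib sum_distrib_left[symmetric] card_Collect_eq_sum)
  also have "\<dots> \<le> card (profiles N n) * (\<eta> * n) + real n * (b * card (profiles N n))"
    using b by (intro add_left_mono mult_left_mono) auto
  also have "\<dots> = real n * ((\<eta> + b) * card (profiles N n))" by (simp add: algebra_simps)
  finally show ?thesis using assms(2) by (simp only: mult_le_cancel_left_pos of_nat_0_less_iff)
qed

text \<open>If \<open>i\<^sub>0\<close> ends at index \<open>m < C\<close> of her list, that school
  has fewer than \<open>M\<close> proposers, or it has at least \<open>M\<close> and ranks fewer
  than \<open>q\<close> of them ahead of her. Both events are summed over \<open>m\<close>.\<close>

lemma card_top_choice_le:
  fixes \<eta> b :: real
  assumes N: "N = n * q" and i: "i\<^sub>0 < N" and C: "C \<le> n" and L: "L \<le> n" and \<eta>: "0 \<le> \<eta>"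
    and b: "\<And>g. g \<in> profiles n N \<Longrightarrow>
      real (card {f \<in> profiles N n. \<eta> * n \<le> card {s\<in>{0..<n}. card (proposers f g T s) < M}})
      \<le> b * card (profiles N n)"
  shows "real (card {P \<in> instances n q. da_state n q P i\<^sub>0 < C})
    \<le> real C * (q / Suc M + \<eta> + b) * card (instances n q)"
proof -
  have inst: "instances n q = profiles N n \<times> profiles n N" unfolding instances_def N ..
  let ?few = "\<lambda>m f g. card (proposers f g T (f i\<^sub>0 ! m)) < M"
  let ?high = "\<lambda>m f g. M \<le> card (proposers f g T (f i\<^sub>0 ! m)) \<and>
     card {j \<in> proposers f g T (f i\<^sub>0 ! m). pos (g (f i\<^sub>0 ! m)) j < pos (g (f i\<^sub>0 ! m)) i\<^sub>0} < q"
  let ?A = "\<lambda>m. {(f, g) \<in> profiles N n \<times> profiles n N. ?few m f g}"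
  let ?B = "\<lambda>m. {(f, g) \<in> profiles N n \<times> profiles n N. ?high m f g}"
  have cA: "real (card (?A m)) \<le> (\<eta> + b) * card (instances n q)" if "m < C" for m
  proof -
    have "real (card (?A m)) = (\<Sum>g\<in>profiles n N. real (card {f \<in> profiles N n. ?few m f g}))"
      by (subst card_filter_Times') auto
    also have "\<dots> \<le> (\<Sum>g\<in>profiles n N. (\<eta> + b) * card (profiles N n))"
      by (intro sum_mono card_choice_few_proposers_le) (use i C \<eta> b that in auto)
    finally show ?thesis unfolding inst by (simp add: card_cartesian_product mult_ac)
  qed
  have cB: "real (card (?B m)) \<le> q / Suc M * card (instances n q)" if "m < C" for m
  proof -
    have "real (card (?B m)) = (\<Sum>f\<in>profiles N n. real (card {g \<in> profiles n N. ?high m f g}))"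
      by (subst card_filter_Times) auto
    also have "\<dots> \<le> (\<Sum>f\<in>profiles N n. q / Suc M * card (profiles n N))"
    proof (rule sum_mono)
      fix f assume f: "f \<in> profiles N n"
      have "f i\<^sub>0 ! m < n"
        using profilesD[OF f i] nth_mem[of m "f i\<^sub>0"] that C by simp
      then have "Suc M * card {g \<in> profiles n N. ?high m f g} \<le> q * card (profiles n N)"
        by (rule card_high_rank_le[OF f i L])
      then have "real (Suc M * card {g \<in> profiles n N. ?high m f g}) \<le> real (q * card (profiles n N))"
        by (simp only: of_nat_le_iff)
      then have "real (Suc M) * real (card {g \<in> profiles n N. ?high m f g}) \<le> real q * real (card (profiles n N))"
        by (simp only: of_nat_mult)
      then show "real (card {g \<in> profiles n N. ?high m f g}) \<le> q / Suc M * card (profiles n N)"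
        by (simp only: times_divide_eq_left pos_le_divide_eq of_nat_0_less_iff zero_less_Suc mult.commute)
    qed
    finally show ?thesis unfolding inst by (simp add: card_cartesian_product mult_ac)
  qed
  have "{P \<in> instances n q. da_state n q P i\<^sub>0 < C} \<subseteq> (\<Union>m<C. ?A m \<union> ?B m)"
  proof
    fix P assume P: "P \<in> {P \<in> instances n q. da_state n q P i\<^sub>0 < C}"
    obtain f g where fg: "P = (f, g)" by (cases P)
    let ?m = "da_state n q P i\<^sub>0"
    have "card {j \<in> proposers (fst P) (snd P) T (fst P i\<^sub>0 ! ?m).
        pos (snd P (fst P i\<^sub>0 ! ?m)) j < pos (snd P (fst P i\<^sub>0 ! ?m)) i\<^sub>0} < q"
      by (rule card_better_proposers_less[OF _ N i refl]) (use P in simp)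
    then have "?few ?m f g \<or> ?high ?m f g" unfolding fg fst_conv snd_conv by linarith
    moreover have "(f, g) \<in> profiles N n \<times> profiles n N" "?m < C" using P fg inst by simp_all
    ultimately have "?m < C" "(f, g) \<in> ?A ?m \<union> ?B ?m" by blast+
    then show "P \<in> (\<Union>m<C. ?A m \<union> ?B m)" unfolding fg by blast
  qed
  then have "card {P \<in> instances n q. da_state n q P i\<^sub>0 < C} \<le> card (\<Union>m<C. ?A m \<union> ?B m)"
    by (intro card_mono finite_UN_I finite_subset[of "?A _ \<union> ?B _" "profiles N n \<times> profiles n N"]) auto
  also have "\<dots> \<le> (\<Sum>m<C. card (?A m \<union> ?B m))" by (rule card_UN_le) simp
  also have "\<dots> \<le> (\<Sum>m<C. card (?A m) + card (?B m))" by (intro sum_mono card_Un_le)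
  finally have "real (card {P \<in> instances n q. da_state n q P i\<^sub>0 < C}) \<le> (\<Sum>m<C. real (card (?A m)) + real (card (?B m)))"
    by (simp only: of_nat_le_iff of_nat_sum[symmetric] of_nat_add[symmetric])
  also have "\<dots> \<le> (\<Sum>m<C. (\<eta> + b) * card (instances n q) + q / Suc M * card (instances n q))"
    by (intro sum_mono add_mono cA cB) auto
  also have "\<dots> = real C * (q / Suc M + \<eta> + b) * card (instances n q)" by (simp add: algebra_simps)
  finally show ?thesis .
qed

end

text \<open>Markov's inequality: the expected number of students with fewer than \<open>C\<close>
  rejections is at most \<open>n * q * x\<close>.\<close>

lemma card_many_top_choice_le:
  fixes x \<delta> :: real
  assumes "\<And>i. i < n * q \<Longrightarrow> real (card {P \<in> instances n q. da_state n q P i < C}) \<le> x * card (instances n q)"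
    and "0 < \<delta>" "0 < n"
  shows "real (card {P \<in> instances n q. \<delta> * n \<le> card {i\<in>{0..<n * q}. da_state n q P i < C}})
     \<le> q * x / \<delta> * card (instances n q)"
proof -
  let ?X = "{P \<in> instances n q. \<delta> * n \<le> card {i\<in>{0..<n * q}. da_state n q P i < C}}"
  have fin: "finite (instances n q)" by (simp add: instances_def)
  have "real (card ?X) * (\<delta> * n) \<le> (\<Sum>P\<in>?X. real (card {i\<in>{0..<n * q}. da_state n q P i < C}))"
    by (rule sum_bounded_below) simp
  also have "\<dots> \<le> (\<Sum>P\<in>instances n q. real (card {i\<in>{0..<n * q}. da_state n q P i < C}))"
    by (rule sum_mono2) (use fin in auto)
  also have "\<dots> = real (card {(P, i) \<in> instances n q \<times> {0..<n * q}. da_state n q P i < C})"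
    by (subst card_filter_Times) (use fin in auto)
  also have "\<dots> = (\<Sum>i\<in>{0..<n * q}. real (card {P\<in>instances n q. da_state n q P i < C}))"
    by (subst card_filter_Times') (use fin in auto)
  also have "\<dots> \<le> (\<Sum>i\<in>{0..<n * q}. x * card (instances n q))" by (rule sum_mono) (use assms in auto)
  also have "\<dots> = real n * (q * x * card (instances n q))" by simp
  finally have "real n * (real (card ?X) * \<delta>) \<le> real n * (q * x * card (instances n q))"
    by (simp only: mult_ac)
  then have "real (card ?X) * \<delta> \<le> q * x * card (instances n q)"
    using assms(3) by (simp only: mult_le_cancel_left_pos of_nat_0_less_iff)
  then show ?thesis using assms(2) by (simp add: field_simps)
qed

section \<open>Short prefixes avoiding a large set of schools\<close>

text \<open>The event forced by a small cover when most students are rejected often. It depends on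
  the preferences alone, so it needs no analysis of deferred acceptance.\<close>

definition prefix_gap :: "nat \<Rightarrow> nat \<Rightarrow> nat \<Rightarrow> real \<Rightarrow> (nat \<Rightarrow> nat list) \<Rightarrow> bool" where
  "prefix_gap N n C \<delta> f \<longleftrightarrow> (\<exists>A B. A \<subseteq> {0..<N} \<and> B \<subseteq> {0..<n} \<and> \<delta> * n \<le> card A \<and> \<delta> * n \<le> card B \<and>
     (\<forall>i\<in>A. set (take C (f i)) \<inter> B = {}))"

text \<open>Lists are independent, so one-student bounds multiply. As \<open>C\<close> is at most
  \<open>\<delta> * n / 2\<close>, the ratio of \<open>n - card B\<close> to \<open>n - C\<close> is
  at most \<open>1 - \<delta> / 2\<close>.\<close>

lemma card_prefixes_avoiding_le:
  fixes \<delta> :: real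
  assumes "A \<subseteq> {0..<N}" "B \<subseteq> {0..<n}" "\<delta> * n \<le> card B" "real C \<le> \<delta> * n / 2" "C < n" "\<delta> \<le> 1" "0 \<le> \<delta>"
  shows "real (card {f \<in> profiles N n. \<forall>i\<in>A. set (take C (f i)) \<inter> B = {}})
     \<le> (1 - \<delta> / 2) ^ (C * card A) * card (profiles N n)"
proof -
  let ?P = "permutations_of_set {0..<n}"
  let ?X = "{xs \<in> ?P. set (take C xs) \<inter> B = {}}"
  have fA: "finite A" using assms(1) finite_subset by auto
  have cB: "card B \<le> n" using card_mono[OF _ assms(2)] by simp
  have "card ?X * (n - C) ^ C \<le> (n - card B) ^ C * fact n"
    by (rule card_permutations_prefix_avoiding_le) (use assms in auto)
  then have "real (card ?X * (n - C) ^ C) \<le> real ((n - card B) ^ C * fact n)" by (simp only: of_nat_le_iff)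
  then have "real (card ?X) * real (n - C) ^ C \<le> real (n - card B) ^ C * fact n" by simp
  also have "\<dots> \<le> ((1 - \<delta> / 2) * real (n - C)) ^ C * fact n"
  proof (intro mult_right_mono power_mono)
    have "\<delta> * real C \<ge> 0" using assms by simp
    moreover have "(1 - \<delta> / 2) * (real n - real C) = real n - real C - \<delta> * n / 2 + \<delta> * C / 2"
      by (simp add: field_simps)
    ultimately have "real n - real (card B) \<le> (1 - \<delta> / 2) * (real n - real C)"
      using assms(3,4) by linarith
    then show "real (n - card B) \<le> (1 - \<delta> / 2) * real (n - C)"
      using cB assms(5) by (simp add: of_nat_diff)
  qed simp_all
  also have "\<dots> = ((1 - \<delta> / 2) ^ C * fact n) * real (n - C) ^ C" by (simp add: power_mult_distrib)
  finally have X: "real (card ?X) \<le> (1 - \<delta> / 2) ^ C * fact n"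
    using assms(5) by (simp only: mult_le_cancel_right_pos zero_less_power of_nat_0_less_iff zero_less_diff)
  have "{f \<in> profiles N n. \<forall>i\<in>A. set (take C (f i)) \<inter> B = {}} = PiE {0..<N} (\<lambda>i. if i \<in> A then ?X else ?P)"
    using assms(1) by (fastforce simp: PiE_iff split: if_splits)
  then have "real (card {f \<in> profiles N n. \<forall>i\<in>A. set (take C (f i)) \<inter> B = {}})
     = (\<Prod>i\<in>{0..<N}. real (card (if i \<in> A then ?X else ?P)))"
    by (simp add: card_PiE)
  also have "\<dots> \<le> (\<Prod>i\<in>{0..<N}. (if i \<in> A then (1 - \<delta> / 2) ^ C else 1) * fact n)"
    by (rule prod_mono) (use X in auto)
  also have "\<dots> = (\<Prod>i\<in>{0..<N}. if i \<in> A then (1 - \<delta> / 2) ^ C else 1) * fact n ^ N"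
    by (simp add: prod.distrib)
  also have "(\<Prod>i\<in>{0..<N}. if i \<in> A then (1 - \<delta> / 2) ^ C else 1) = ((1 - \<delta> / 2) ^ C) ^ card A"
    using assms(1) by (simp add: prod.inter_restrict[symmetric] inf_absorb2)
  finally show ?thesis by (simp add: card_profiles power_mult)
qed

text \<open>Union bound over at most \<open>2 ^ N * 2 ^ n\<close> pairs. In
  \<open>C = D * C'\<close> the factor \<open>D\<close> makes up for \<open>A\<close> having only
  \<open>\<delta> * n\<close> elements, and \<open>C'\<close> beats the number of pairs.\<close>

lemma card_prefix_gap_le:
  fixes \<delta> :: real and C' D :: nat
  assumes "0 < \<delta>" "\<delta> \<le> 1" "1 \<le> \<delta> * D" "2 ^ (q + 1) * (1 - \<delta> / 2) ^ C' \<le> 1 / 2"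
    and "C = D * C'" "real C \<le> \<delta> * n / 2" "C < n" and N: "N = n * q"
  shows "real (card {f \<in> profiles N n. prefix_gap N n C \<delta> f}) \<le> (1 / 2) ^ n * card (profiles N n)"
proof -
  let ?I = "{(A, B). A \<subseteq> {0..<N} \<and> B \<subseteq> {0..<n} \<and> \<delta> * n \<le> card A \<and> \<delta> * n \<le> card B}"
  let ?Y = "\<lambda>(A, B). {f \<in> profiles N n. \<forall>i\<in>A. set (take C (f i)) \<inter> B = {}}"
  have sub: "?I \<subseteq> Pow {0..<N} \<times> Pow {0..<n}" by auto
  have fin: "finite ?I" by (rule finite_subset[OF sub]) simp
  have "card ?I \<le> card (Pow {0..<N} \<times> Pow {0..<n})" by (rule card_mono[OF _ sub]) simp
  then have cI: "card ?I \<le> 2 ^ N * 2 ^ n" by (simp add: card_cartesian_product card_Pow)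
  have Y: "real (card (?Y p)) \<le> (1 - \<delta> / 2) ^ (C' * n) * card (profiles N n)" if p: "p \<in> ?I" for p
  proof -
    obtain A B where AB: "p = (A, B)" by (cases p)
    have *: "A \<subseteq> {0..<N}" "B \<subseteq> {0..<n}" "\<delta> * n \<le> card A" "\<delta> * n \<le> card B" using p AB by auto
    have "real n \<le> (\<delta> * D) * n" using mult_right_mono[OF assms(3), of "real n"] by simp
    also have "\<dots> = D * (\<delta> * n)" by simp
    also have "\<dots> \<le> D * card A" using mult_left_mono[OF *(3), of "real D"] by simp
    finally have "real n \<le> real (D * card A)" by simp
    then have "n \<le> D * card A" by (simp only: of_nat_le_iff)
    then have "C' * n \<le> C * card A" unfolding assms(5) by (metis mult.assoc mult.commute mult_le_mono2)
    then have "(1 - \<delta> / 2) ^ (C * card A) \<le> (1 - \<delta> / 2) ^ (C' * n)"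
      using assms by (intro power_decreasing) auto
    moreover have "real (card (?Y p)) \<le> (1 - \<delta> / 2) ^ (C * card A) * card (profiles N n)"
      unfolding AB prod.case by (rule card_prefixes_avoiding_le) (use * assms in auto)
    ultimately show ?thesis by (meson mult_right_mono of_nat_0_le_iff order_trans)
  qed
  have "{f \<in> profiles N n. prefix_gap N n C \<delta> f} \<subseteq> (\<Union>p\<in>?I. ?Y p)"
    by (auto simp: prefix_gap_def)
  then have "card {f \<in> profiles N n. prefix_gap N n C \<delta> f} \<le> card (\<Union>p\<in>?I. ?Y p)"
    by (intro card_mono finite_UN_I[OF fin] finite_subset[OF _ finite_profiles[of N n]]) auto
  also have "\<dots> \<le> (\<Sum>p\<in>?I. card (?Y p))" by (rule card_UN_le[OF fin])
  finally have "real (card {f \<in> profiles N n. prefix_gap N n C \<delta> f}) \<le> (\<Sum>p\<in>?I. real (card (?Y p)))"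
    by (simp only: of_nat_le_iff of_nat_sum[symmetric])
  also have "\<dots> \<le> real (card ?I) * ((1 - \<delta> / 2) ^ (C' * n) * card (profiles N n))"
    by (rule sum_bounded_above) (rule Y)
  also have "\<dots> \<le> (2 ^ N * 2 ^ n) * ((1 - \<delta> / 2) ^ (C' * n) * card (profiles N n))"
  proof (rule mult_right_mono)
    have "real (card ?I) \<le> real (2 ^ N * 2 ^ n)" using cI by (simp only: of_nat_le_iff)
    then show "real (card ?I) \<le> 2 ^ N * 2 ^ n" by simp
  qed (use assms in auto)
  also have "\<dots> = (2 ^ (q + 1) * (1 - \<delta> / 2) ^ C') ^ n * card (profiles N n)"
    unfolding N by (simp add: power_mult_distrib power_mult[symmetric] power_add mult_ac)
  also have "\<dots> \<le> (1 / 2) ^ n * card (profiles N n)"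
    using assms by (intro mult_right_mono power_mono) auto
  finally show ?thesis .
qed

section \<open>From an acyclic uncovered set to a prefix gap\<close>

text \<open>Elements are added one at a time, each minimal among those left for the well-founded
  relation, so that no edge enters \<open>B\<close> from outside.\<close>

lemma acyclic_predecessor_closed_subset:
  assumes "finite U" "acyclic {(x, y). x \<in> U \<and> y \<in> U \<and> E x y}" "b \<le> card U"
  shows "\<exists>B\<subseteq>U. card B = b \<and> (\<forall>x\<in>U - B. \<forall>y\<in>B. \<not> E x y)"
  using assms(3)
proof (induction b)
  case 0
  show ?case by (rule exI[of _ "{}"]) simp
next
  case (Suc b)
  then obtain B where B: "B \<subseteq> U" "card B = b" "\<forall>x\<in>U - B. \<forall>y\<in>B. \<not> E x y" by auto
  let ?R = "{(x, y). x \<in> U \<and> y \<in> U \<and> E x y}"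
  have "finite ?R" by (rule finite_subset[of _ "U \<times> U"]) (use assms(1) in auto)
  then have "wf ?R" using assms(2) by (rule finite_acyclic_wf)
  moreover have "B \<noteq> U" using B(2) Suc.prems by auto
  then obtain z where "z \<in> U - B" using B(1) by auto
  ultimately obtain y where y: "y \<in> U - B" "\<And>x. (x, y) \<in> ?R \<Longrightarrow> x \<notin> U - B"
    by (rule wfE_min) blast
  show ?case
  proof (intro exI conjI)
    show "insert y B \<subseteq> U" using B(1) y(1) by auto
    show "card (insert y B) = Suc b"
      using B(1,2) y(1) finite_subset[OF B(1) assms(1)] by simp
    show "\<forall>x\<in>U - insert y B. \<forall>z\<in>insert y B. \<not> E x z" using B(3) y by auto
  qed
qed

text \<open>One half \<open>B\<close> of the uncovered students is envied by nobody in the other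
  half. The students there with at least \<open>C\<close> rejections form \<open>A\<close>, and the
  schools assigned to \<open>B\<close> are missing from their first \<open>C\<close>
  choices.\<close>

lemma small_cover_imp_prefix_gap:
  fixes \<epsilon> \<delta> :: real
  assumes P: "P \<in> instances n q" and H: "cycle_packing {0..<n * q} (envy n q P) H"
    and small: "real (card (cover H)) < (1 - \<epsilon>) * real (n * q)"
    and q: "0 < q" and \<delta>: "0 < \<delta>" "4 * \<delta> \<le> \<epsilon>" and n: "1 \<le> \<delta> * n"
    and few: "real (card {i\<in>{0..<n * q}. da_state n q P i < C}) < \<delta> * n"
  shows "prefix_gap (n * q) n C \<delta> (fst P)"
proof -
  let ?V = "{0..<n * q}" and ?k = "da_state n q P"
  define U where "U = ?V - cover H"
  have fU: "finite U" by (simp add: U_def)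
  have "cover H \<subseteq> ?V" using H by (auto simp: cycle_packing_def cover_def is_dcycle_def)
  then have "card U = n * q - card (cover H)" unfolding U_def by (subst card_Diff_subset) (auto intro: finite_subset)
  then have "real (n * q) \<le> real (card U) + real (card (cover H))" by linarith
  then have "real (card U) > \<epsilon> * real (n * q)" using small by (simp add: algebra_simps)
  \<comment> \<open>The factor 4 pays for halving \<open>U\<close>, for the rounding of
    \<open>card U div 2\<close>, and for removing the fewer than \<open>\<delta> * n\<close>
    students rejected less than \<open>C\<close> times.\<close>
  moreover have "\<epsilon> * real (n * q) \<ge> 4 * \<delta> * real (n * q)" using \<delta> by (intro mult_right_mono) auto
  ultimately have cU: "real (card U) > 4 * (\<delta> * n) * q" by (simp add: mult_ac)
  have q1: "\<delta> * n \<le> \<delta> * n * q" using mult_left_mono[of 1 "real q" "\<delta> * n"] q \<delta>(1) by simp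
  have "acyclic {(x, y). x \<in> U \<and> y \<in> U \<and> envy n q P x y}" using H by (simp add: cycle_packing_def U_def)
  then obtain B where B: "B \<subseteq> U" "card B = card U div 2" "\<forall>x\<in>U - B. \<forall>y\<in>B. \<not> envy n q P x y"
    using acyclic_predecessor_closed_subset[OF fU, of "envy n q P" "card U div 2"] by auto
  define A where "A = {i\<in>U - B. C \<le> ?k i}"
  define S where "S = DA n q P ` B"
  have UV: "U \<subseteq> ?V" by (simp add: U_def)
  have SV: "S \<subseteq> {0..<n}" using B(1) UV DA_less[OF P] by (auto simp: S_def)
  have fB: "finite B" using B(1) fU by (rule finite_subset)
  have "real (card U) \<le> 2 * real (card B) + 1" using B(2) by simp
  then have cB: "real (card B) \<ge> \<delta> * n * q" using cU q1 n by linarith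
  \<comment> \<open>Each school takes at most \<open>q\<close> students, so \<open>B\<close>
    occupies at least \<open>card B / q\<close> schools.\<close>
  have "card B = (\<Sum>s\<in>S. card {i\<in>B. DA n q P i = s})" unfolding S_def by (rule card_eq_sum_fibres[OF fB])
  also have "\<dots> \<le> (\<Sum>s\<in>S. q)"
  proof (rule sum_mono)
    fix s assume "s \<in> S"
    then have "s < n" using SV by auto
    have "card {i\<in>B. DA n q P i = s} \<le> card {i\<in>?V. DA n q P i = s}"
      by (rule card_mono) (use B(1) UV in auto)
    also have "\<dots> \<le> q" by (rule card_DA_preimage_le[OF P \<open>s < n\<close>])
    finally show "card {i\<in>B. DA n q P i = s} \<le> q" .
  qed
  finally have "card B \<le> card S * q" by simp
  then have "real (card B) \<le> real (card S * q)" by (simp only: of_nat_le_iff)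
  then have "\<delta> * n * q \<le> card S * q" using cB by simp
  then have cS: "\<delta> * n \<le> card S" using q by simp
  have cUB: "card (U - B) = card U - card B" using B(1) fB by (simp add: card_Diff_subset)
  have "U - B \<subseteq> A \<union> {i\<in>?V. ?k i < C}" using UV by (auto simp: A_def)
  then have "card (U - B) \<le> card (A \<union> {i\<in>?V. ?k i < C})" by (rule card_mono[rotated]) (simp add: A_def fU)
  also have "\<dots> \<le> card A + card {i\<in>?V. ?k i < C}" by (rule card_Un_le)
  finally have "card U - card B \<le> card A + card {i\<in>?V. ?k i < C}" unfolding cUB .
  then have "real (card U) - real (card B) \<le> real (card A) + real (card {i\<in>?V. ?k i < C})" by linarith
  moreover have "2 * real (card B) \<le> real (card U)" using B(2) by simp
  ultimately have cA: "\<delta> * n \<le> card A" using few cU q1 by linarith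
  have "set (take C (fst P i)) \<inter> S = {}" if i: "i \<in> A" for i
  proof -
    have "DA n q P j \<notin> set (take C (fst P i))" if j: "j \<in> B" for j
    proof -
      have "DA n q P j \<notin> set (take (?k i) (fst P i))"
        by (rule not_envy_DA_notin_prefix[OF P]) (use i j B UV in \<open>auto simp: A_def\<close>)
      moreover have "set (take C (fst P i)) \<subseteq> set (take (?k i) (fst P i))"
        by (rule set_take_subset_set_take) (use i in \<open>simp add: A_def\<close>)
      ultimately show ?thesis by blast
    qed
    then show ?thesis by (auto simp: S_def)
  qed
  then show ?thesis unfolding prefix_gap_def
    using SV cS cA UV by (intro exI[of _ A] exI[of _ S]) (auto simp: A_def)
qed

section \<open>Choice of constants and passage to the limit\<close>

lemma eventually_real_ge: "\<forall>\<^sub>F n in sequentially. c \<le> real n"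
  by (rule eventually_compose_filterlim[OF eventually_ge_at_top filterlim_real_sequentially])

text \<open>The constants are fixed in the order \<open>M\<close>, \<open>\<eta>\<close>,
  \<open>K\<close>, \<open>L\<close>. Only then does \<open>n\<close> grow, so the factor
  \<open>exp (2 * L * K)\<close> in \<open>b n\<close> is constant and \<open>b n\<close> tends to
  0.\<close>

lemma eventually_many_top_choice_le:
  fixes \<delta> \<gamma> :: real and q C :: nat
  assumes q: "0 < q" and \<delta>: "0 < \<delta>" and \<gamma>: "0 < \<gamma>"
  shows "\<forall>\<^sub>F n in sequentially.
    real (card {P \<in> instances n q. \<delta> * n \<le> card {i\<in>{0..<n * q}. da_state n q P i < C}})
      \<le> \<gamma> * card (instances n q)"
proof -
  \<comment> \<open>Taking \<open>Suc C\<close> keeps the denominator of \<open>y\<close> positive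
    when \<open>C = 0\<close>.\<close>
  define c where "c = real (Suc C)"
  have c: "0 < c" "C \<le> c" by (simp_all add: c_def)
  \<comment> \<open>Each of the three error terms, \<open>q / Suc M\<close>, \<open>\<eta>\<close>
    and \<open>b n\<close>, is kept at most \<open>y\<close>; summing over \<open>C\<close> choices
    and applying Markov then gives at most \<open>\<gamma>\<close>.\<close>
  define y where "y = \<gamma> * \<delta> / (3 * q * c)"
  have y: "0 < y" using assms c by (simp add: y_def)
  obtain M :: nat where "q / y < real M" using reals_Archimedean2 by blast
  then have M: "q / Suc M \<le> y" using y by (simp add: field_simps)
  define \<eta> where "\<eta> = min 1 y"
  have \<eta>: "0 < \<eta>" "\<eta> \<le> 1" "\<eta> \<le> y" using y by (auto simp: \<eta>_def)
  obtain K where "(1 - \<eta> / 2) ^ K < 1 / 2 / 2 ^ (M + 1)"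
    using real_arch_pow_inv[of "1 / 2 / 2 ^ (M + 1)" "1 - \<eta> / 2"] \<eta> by auto
  then have K: "2 ^ (M + 1) * (1 - \<eta> / 2) ^ K \<le> 1 / 2" by (simp add: field_simps)
  \<comment> \<open>The cap \<open>L\<close> is chosen after \<open>K\<close>, so large that
    \<open>K / L\<close> is at most \<open>exp (- 2 * K) / 4\<close>: exhausted students are then
    too few to stop the run.\<close>
  obtain l :: nat where l: "4 * K * exp (2 * K) < real l" using reals_Archimedean2 by blast
  define L where "L = Suc l"
  have L: "0 < L" "4 * K * exp (2 * K) \<le> real L" using l by (auto simp: L_def)
  define b where "b n = exp (2 * real L * K) * ((1/2) ^ n + 4 * exp (2 * real K) / real n)" for n
  have "b \<longlonglongrightarrow> exp (2 * real L * K) * (0 + 0)"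
    unfolding b_def
    by (intro tendsto_mult tendsto_const tendsto_add LIMSEQ_power_zero lim_const_over_n) simp
  then have "\<forall>\<^sub>F n in sequentially. b n < y" using y by (intro order_tendstoD) auto
  moreover have "\<forall>\<^sub>F n in sequentially. 4 * exp (2 * real K) \<le> real n" by (rule eventually_real_ge)
  moreover have "\<forall>\<^sub>F n in sequentially. 2 + 2 * L + C \<le> n" by (rule eventually_ge_at_top)
  ultimately show ?thesis
  proof eventually_elim
    fix n assume bn: "b n < y" and n1: "4 * exp (2 * real K) \<le> real n" and n2: "2 + 2 * L + C \<le> n"
    have LK: "1 + real (K * n) / L \<le> real n * exp (- 2 * real K) / 2"
    proof -
      have "1 \<le> real n * exp (- 2 * real K) / 4" using n1 by (simp add: exp_minus field_simps)
      moreover have "real K / L \<le> exp (- 2 * real K) / 4" using L by (simp add: exp_minus field_simps)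
      then have "real n * (real K / L) \<le> real n * (exp (- 2 * real K) / 4)" by (intro mult_left_mono) auto
      ultimately show ?thesis by (simp add: mult.commute)
    qed
    have top: "real (card {P \<in> instances n q. da_state n q P i < C}) \<le> C * (3 * y) * card (instances n q)"
      if i: "i < n * q" for i
    proof -
      have "real (card {P \<in> instances n q. da_state n q P i < C})
          \<le> real C * (q / Suc M + \<eta> + b n) * card (instances n q)"
      proof (rule sequential_da.card_top_choice_le[OF refl])
        fix g assume "g \<in> profiles n (n * q)"
        then show "real (card {f \<in> profiles (n * q) n. \<eta> * n \<le> card {s\<in>{0..<n}.
             card (sequential_da.proposers (n * q) L q i f g (K * n) s) < M}}) \<le> b n * card (profiles (n * q) n)"
          unfolding b_def by (intro few_proposers_ratio_le) (use n2 L q \<eta> K LK in auto)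
      qed (use i n2 \<eta> in auto)
      also have "\<dots> \<le> C * (3 * y) * card (instances n q)"
        using M \<eta>(3) bn by (intro mult_right_mono mult_left_mono) auto
      finally show ?thesis .
    qed
    have "real (card {P \<in> instances n q. \<delta> * n \<le> card {i\<in>{0..<n * q}. da_state n q P i < C}})
        \<le> q * (C * (3 * y)) / \<delta> * card (instances n q)"
      by (rule card_many_top_choice_le[OF top \<delta>]) (use n2 in auto)
    also have "\<dots> \<le> \<gamma> * card (instances n q)"
    proof (rule mult_right_mono)
      have "q * (C * (3 * y)) / \<delta> = \<gamma> * (C / c)" using q \<delta> c by (simp add: y_def field_simps)
      also have "\<dots> \<le> \<gamma> * 1" using \<gamma> c by (intro mult_left_mono) auto
      finally show "q * (C * (3 * y)) / \<delta> \<le> \<gamma>" by simp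
    qed simp
    finally show "real (card {P \<in> instances n q. \<delta> * n \<le> card {i\<in>{0..<n * q}. da_state n q P i < C}})
      \<le> \<gamma> * card (instances n q)" .
  qed
qed

theorem mainTheorem14:
  fixes q :: nat and \<epsilon> :: real
  assumes "q > 0" and "\<epsilon> > 0"
  shows "(\<lambda>n. real (card {P \<in> instances n q.
              \<forall>H. cycle_packing {0..<n*q} (envy n q P) H \<longrightarrow>
                  real (card (cover H)) \<ge> (1 - \<epsilon>) * real (n * q)})
            / real (card (instances n q))) \<longlonglongrightarrow> 1"
proof (rule tendstoI)
  fix \<gamma> :: real assume \<gamma>: "0 < \<gamma>"
  define \<delta> where "\<delta> = min \<epsilon> 1 / 4"
  have \<delta>: "0 < \<delta>" "\<delta> \<le> 1" "4 * \<delta> \<le> \<epsilon>" using assms(2) by (auto simp: \<delta>_def)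
  obtain D :: nat where "1 / \<delta> < real D" using reals_Archimedean2 by blast
  then have D: "1 \<le> \<delta> * D" using \<delta> by (simp add: field_simps)
  \<comment> \<open>\<open>C'\<close> beats \<open>2 ^ (q + 1)\<close>, the growth rate of the
    number of pairs in the union bound.\<close>
  obtain C' where "(1 - \<delta> / 2) ^ C' < 1 / 2 / 2 ^ (q + 1)"
    using real_arch_pow_inv[of "1 / 2 / 2 ^ (q + 1)" "1 - \<delta> / 2"] \<delta> by auto
  then have C': "2 ^ (q + 1) * (1 - \<delta> / 2) ^ C' \<le> 1 / 2" by (simp add: field_simps)
  define C where "C = D * C'"
  have "(\<lambda>n. (1/2 :: real) ^ n) \<longlonglongrightarrow> 0" by (rule LIMSEQ_power_zero) simp
  then have "\<forall>\<^sub>F n in sequentially. (1/2 :: real) ^ n < \<gamma> / 3" using \<gamma> by (intro order_tendstoD) auto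
  \<comment> \<open>The threshold yields at once \<open>C < n\<close>,
    \<open>C \<le> \<delta> * n / 2\<close> and \<open>1 \<le> \<delta> * n\<close>.\<close>
  moreover have "\<forall>\<^sub>F n in sequentially. 2 * C / \<delta> + 1 / \<delta> + C + 1 \<le> real n" by (rule eventually_real_ge)
  moreover have "\<forall>\<^sub>F n in sequentially.
    real (card {P \<in> instances n q. \<delta> * n \<le> card {i\<in>{0..<n * q}. da_state n q P i < C}})
      \<le> \<gamma> / 3 * card (instances n q)"
    by (rule eventually_many_top_choice_le) (use assms \<delta> \<gamma> in auto)
  ultimately show "\<forall>\<^sub>F n in sequentially. dist (real (card {P \<in> instances n q.
              \<forall>H. cycle_packing {0..<n*q} (envy n q P) H \<longrightarrow>
                  real (card (cover H)) \<ge> (1 - \<epsilon>) * real (n * q)})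
            / real (card (instances n q))) 1 < \<gamma>"
  proof eventually_elim
    fix n
    let ?I = "instances n q"
    let ?G = "{P \<in> ?I. \<forall>H. cycle_packing {0..<n*q} (envy n q P) H \<longrightarrow>
                  real (card (cover H)) \<ge> (1 - \<epsilon>) * real (n * q)}"
    let ?X = "{P \<in> ?I. \<delta> * n \<le> card {i\<in>{0..<n * q}. da_state n q P i < C}}"
    let ?Y = "{P \<in> ?I. prefix_gap (n * q) n C \<delta> (fst P)}"
    assume small: "(1/2 :: real) ^ n < \<gamma> / 3" and n: "2 * C / \<delta> + 1 / \<delta> + C + 1 \<le> real n"
      and X: "real (card ?X) \<le> \<gamma> / 3 * card ?I"
    have pos: "0 \<le> 2 * C / \<delta>" "0 \<le> 1 / \<delta>" using \<delta> by auto
    have "C < n" using n pos by linarith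
    have "2 * C / \<delta> \<le> n" "1 / \<delta> \<le> n" using n pos by linarith+
    then have n': "real C \<le> \<delta> * n / 2" "1 \<le> \<delta> * n" using \<delta> by (simp_all add: field_simps)
    have fin: "finite ?I" by (simp add: instances_def)
    have "card ?I = card (profiles (n * q) n) * card (profiles n (n * q))"
      by (simp add: instances_def card_cartesian_product)
    then have I0: "0 < real (card ?I)" by (simp add: card_profiles)
    have "?Y = {f \<in> profiles (n * q) n. prefix_gap (n * q) n C \<delta> f} \<times> profiles n (n * q)"
      by (auto simp: instances_def)
    then have "real (card ?Y) = real (card {f \<in> profiles (n * q) n. prefix_gap (n * q) n C \<delta> f})
        * real (card (profiles n (n * q)))"
      by (simp add: card_cartesian_product)
    also have "\<dots> \<le> ((1/2) ^ n * card (profiles (n * q) n)) * real (card (profiles n (n * q)))"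
      by (intro mult_right_mono card_prefix_gap_le[OF \<delta>(1,2) D C' C_def n'(1) \<open>C < n\<close>]) auto
    also have "\<dots> = (1/2) ^ n * card ?I" by (simp add: instances_def card_cartesian_product)
    also have "\<dots> \<le> \<gamma> / 3 * card ?I" using small by (intro mult_right_mono) auto
    finally have Y: "real (card ?Y) \<le> \<gamma> / 3 * card ?I" .
    \<comment> \<open>A bad instance either has too many students with fewer than \<open>C\<close>
      rejections or has a prefix gap; each case has probability at most
      \<open>\<gamma> / 3\<close>.\<close>
    have "?I - ?G \<subseteq> ?X \<union> ?Y"
    proof
      fix P assume "P \<in> ?I - ?G"
      then obtain H where P: "P \<in> ?I" and H: "cycle_packing {0..<n*q} (envy n q P) H"
        "real (card (cover H)) < (1 - \<epsilon>) * real (n * q)" by force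
      show "P \<in> ?X \<union> ?Y"
      proof (cases "P \<in> ?X")
        case False
        then have "real (card {i\<in>{0..<n * q}. da_state n q P i < C}) < \<delta> * n" using P by auto
        then have "prefix_gap (n * q) n C \<delta> (fst P)"
          by (rule small_cover_imp_prefix_gap[OF P H assms(1) \<delta>(1,3) n'(2)])
        then show ?thesis using P by blast
      qed blast
    qed
    then have "card (?I - ?G) \<le> card (?X \<union> ?Y)" by (intro card_mono) (use fin in auto)
    also have "\<dots> \<le> card ?X + card ?Y" by (rule card_Un_le)
    finally have "real (card (?I - ?G)) \<le> 2 * \<gamma> / 3 * card ?I" using X Y by simp
    moreover have "card (?I - ?G) = card ?I - card ?G" by (rule card_Diff_subset) (use fin in auto)
    moreover have GI: "card ?G \<le> card ?I" by (rule card_mono) (use fin in auto)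
    ultimately have "real (card ?I) - real (card ?G) \<le> 2 * \<gamma> / 3 * card ?I" by (simp add: of_nat_diff)
    also have "\<dots> < \<gamma> * card ?I" using \<gamma> I0 by (intro mult_strict_right_mono) auto
    finally have "1 - real (card ?G) / card ?I < \<gamma>" using I0 by (simp add: field_simps)
    moreover have "real (card ?G) / card ?I \<le> 1" using GI I0 by simp
    ultimately show "dist (real (card ?G) / real (card ?I)) 1 < \<gamma>" by (simp add: dist_real_def)
  qed
qed

end
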